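(* If the group $G$ admits a finite complete rewriting system, then $G$ is regularly stackable.
   Context: A finite complete rewriting system for a group $G$ consists of a finite set $A$ and a finite set of rules $R\subseteq A^*\times A^*$ (each $(u,v)\in R$ written $u\to v$) such that as a monoid $G$ is presented by $Mon\langle A\mid u=v\text{ whenever }u\to v\in R\rangle$, and the rewritings $xuy\to xvy$ ($x,y\in A^*$, $u\to v$ in $R$) satisfy: each $g\in G$ is represented by exactly one irreducible word over $A$ (a word that cannot be rewritten); and there is no infinite chain of rewritings $w\to x_1\to x_2\to\cdots$. Stackings. Let $A$ be a finite symmetric (inverse-closed) generating set of $G$, no element of which represents the identity $\epsilon$; $1$ is the empty word; $=_G$ denotes equality in $G$. $\Gamma$ is the Cayley graph with respect to $A$, with directed edges $\vec E(\Gamma)$; $e_{g,a}$ is the directed edge labeled $a$ from $g$ to $ga$, and $e_{x,a}:=e_{g,a}$ if $x\in A^*$ represents $g$. A set of normal forms $\mathcal N=\{y_g\mid g\in G\}\subseteq A^*$ contains exactly one word $y_g$ representing each $g$. Degenerate edges: $\vec E_d:=\{e_{g,a}\mid y_ga=y_{ga}\text{ or }y_g=y_{ga}a^{-1}\text{ as words}\}$; recursive edges: $\vec E_r:=\vec E(\Gamma)\setminus\vec E_d$. For $c:\vec E_r\to A^*$, $<_c$ is the transitive closure of the relation: $e'<_c e$ whenever $e,e'\in\vec E_r$ and $e'$ lies (with the direction of the path) on the path in $\Gamma$ starting at the initial vertex of $e$ labeled $c(e)$. A stacking for $G$ with respect to $A$ is a pair $(\mathcal N,c)$ with $y_\epsilon=1$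 and: (S1) $c(e_{g,a})=_Ga$ for $e_{g,a}\in\vec E_r$; (S2) $<_c$ is a strict partial ordering and each $e\in\vec E_r$ has only finitely many $e''\in\vec E_r$ with $e''<_ce$; (S3) $c(\vec E_r)$ is finite. Let $c'(e):=c(e)$ for $e\in\vec E_r$, $c'(e):=a$ for $e\in\vec E_d$ labeled $a$, and $S_c:=\{(w,a,c'(e_{w,a}))\mid w\in A^*,a\in A\}\subseteq A^*\times A\times A^*$. $G$ is regularly stackable if it has a finite symmetric generating set $A$ with a stacking $(\mathcal N,c)$ such that $\mathcal N$ is a regular language and $S_c$ is recursive. *)

theory Defs
  imports "HOL-Algebra.Generated_Groups" "HOL-Library.Nat_Bijection"
begin

inductive_set mon_cong :: "'b set \<Rightarrow> ('b list \<times> 'b list) set \<Rightarrow> ('b list \<times> 'b list) set"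
  for A :: "'b set" and R :: "('b list \<times> 'b list) set" where
  base: "(u, v) \<in> R \<Longrightarrow> (u, v) \<in> mon_cong A R"
| refl: "w \<in> lists A \<Longrightarrow> (w, w) \<in> mon_cong A R"
| sym: "(u, v) \<in> mon_cong A R \<Longrightarrow> (v, u) \<in> mon_cong A R"
| trans: "(u, v) \<in> mon_cong A R \<Longrightarrow> (v, w) \<in> mon_cong A R \<Longrightarrow> (u, w) \<in> mon_cong A R"
| append: "(u, u') \<in> mon_cong A R \<Longrightarrow> (v, v') \<in> mon_cong A R \<Longrightarrow> (u @ v, u' @ v') \<in> mon_cong A R"

text \<open>The monoid \<open>Mon\<langle>A | u = v for (u, v) in R\<rangle>\<close>.\<close>

definition presented_monoid ::
    "'b set \<Rightarrow> ('b list \<times> 'b list) set \<Rightarrow> 'b list set monoid" where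
  "presented_monoid A R =
     \<lparr>carrier = lists A // mon_cong A R,
      mult = (\<lambda>C D. \<Union>x\<in>C. \<Union>y\<in>D. mon_cong A R `` {x @ y}),
      one = mon_cong A R `` {[]}\<rparr>"

definition rewriting_step :: "'b set \<Rightarrow> ('b list \<times> 'b list) set \<Rightarrow> ('b list \<times> 'b list) set" where
  "rewriting_step A R =
     {(x @ u @ y, x @ v @ y) | x u v y. x \<in> lists A \<and> y \<in> lists A \<and> (u, v) \<in> R}"

definition irreducible_word :: "'b set \<Rightarrow> ('b list \<times> 'b list) set \<Rightarrow> 'b list \<Rightarrow> bool" where
  "irreducible_word A R w \<longleftrightarrow> w \<in> lists A \<and> (\<nexists>w'. (w, w') \<in> rewriting_step A R)"

text \<open>
  The isomorphism \<open>\<phi>\<close> from the presented monoid to \<open>G\<close> says which group element a word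
  represents. The alphabet is abstract: distinct letters may represent the same element
  of \<open>G\<close>, and a letter may represent the identity.
\<close>

definition finite_complete_rewriting_system ::
    "('a, 'm) monoid_scheme \<Rightarrow> 'b set \<Rightarrow> ('b list \<times> 'b list) set \<Rightarrow> ('b list set \<Rightarrow> 'a) \<Rightarrow> bool" where
  "finite_complete_rewriting_system G A R \<phi> \<longleftrightarrow>
     finite A \<and> finite R \<and> R \<subseteq> lists A \<times> lists A \<and>
     \<phi> \<in> iso (presented_monoid A R) G \<and>
     (\<forall>g\<in>carrier G. \<exists>!w. irreducible_word A R w \<and> \<phi> (mon_cong A R `` {w}) = g) \<and>
     (\<nexists>f :: nat \<Rightarrow> 'b list. \<forall>i. (f i, f (Suc i)) \<in> rewriting_step A R)"

definition regular_language :: "'a set \<Rightarrow> 'a list set \<Rightarrow> bool" where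
  "regular_language A L \<longleftrightarrow>
     (\<exists>(Q :: nat set) q0 F \<delta>.
        finite Q \<and> q0 \<in> Q \<and> F \<subseteq> Q \<and> (\<forall>q\<in>Q. \<forall>a\<in>A. \<delta> q a \<in> Q) \<and>
        L = {w \<in> lists A. foldl \<delta> q0 w \<in> F})"

text \<open>
  \<open>recursive_fun n f\<close>: the restriction of \<open>f\<close> to lists of length \<open>n\<close> is an \<open>n\<close>-ary total
  (general) recursive function; minimization is applied to regular functions only.
\<close>

inductive recursive_fun :: "nat \<Rightarrow> (nat list \<Rightarrow> nat) \<Rightarrow> bool" where
  zero: "recursive_fun n (\<lambda>xs. 0)"
| succ: "recursive_fun 1 (\<lambda>xs. Suc (xs ! 0))"
| proj: "i < n \<Longrightarrow> recursive_fun n (\<lambda>xs. xs ! i)"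
| comp: "recursive_fun (length gs) f \<Longrightarrow> (\<And>g. g \<in> set gs \<Longrightarrow> recursive_fun n g) \<Longrightarrow>
    recursive_fun n (\<lambda>xs. f (map (\<lambda>g. g xs) gs))"
| prim_rec: "recursive_fun n f \<Longrightarrow> recursive_fun (Suc (Suc n)) g \<Longrightarrow>
    recursive_fun (Suc n)
      (\<lambda>xs. rec_nat (f (tl xs)) (\<lambda>k r. g (k # r # tl xs)) (hd xs))"
| minimize: "recursive_fun (Suc n) f \<Longrightarrow> (\<And>xs. length xs = n \<Longrightarrow> \<exists>k. f (k # xs) = 0) \<Longrightarrow>
    recursive_fun n (\<lambda>xs. LEAST k. f (k # xs) = 0)"

definition recursive_relation :: "nat \<Rightarrow> nat list set \<Rightarrow> bool" where
  "recursive_relation n S \<longleftrightarrow>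
     (\<exists>f. recursive_fun n f \<and> (\<forall>xs. length xs = n \<longrightarrow> f xs = (if xs \<in> S then 1 else 0)))"

text \<open>
  Recursiveness of a subset of \<open>A* \<times> A \<times> A*\<close>, for finite \<open>A\<close>: number the letters and code
  words by \<open>list_encode\<close>. As \<open>A\<close> is finite, any two numberings differ by a recursive
  translation, so the choice of \<open>\<iota>\<close> does not matter.
\<close>

definition recursive_triples :: "'a set \<Rightarrow> ('a list \<times> 'a \<times> 'a list) set \<Rightarrow> bool" where
  "recursive_triples A S \<longleftrightarrow>
     (\<exists>\<iota>. bij_betw \<iota> A {..<card A} \<and>
        recursive_relation 3
          {[list_encode (map \<iota> w), \<iota> a, list_encode (map \<iota> x)] | w a x. (w, a, x) \<in> S})"

text \<open>
  Generators are elements of \<open>G\<close>, and the directed edge \<open>e\<^bsub>g,a\<^esub>\<close> of the Cayley graph is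
  the pair \<open>(g, a)\<close>.
\<close>

definition word_val :: "('a, 'm) monoid_scheme \<Rightarrow> 'a list \<Rightarrow> 'a" where
  "word_val G w = foldr (\<lambda>a g. a \<otimes>\<^bsub>G\<^esub> g) w \<one>\<^bsub>G\<^esub>"

definition symmetric_generating_set :: "('a, 'm) monoid_scheme \<Rightarrow> 'a set \<Rightarrow> bool" where
  "symmetric_generating_set G A \<longleftrightarrow>
     A \<subseteq> carrier G \<and> generate G A = carrier G \<and> (\<forall>a\<in>A. inv\<^bsub>G\<^esub> a \<in> A) \<and> \<one>\<^bsub>G\<^esub> \<notin> A"

definition normal_forms :: "('a, 'm) monoid_scheme \<Rightarrow> 'a set \<Rightarrow> 'a list set \<Rightarrow> bool" where
  "normal_forms G A N \<longleftrightarrow>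
     N \<subseteq> lists A \<and> (\<forall>g\<in>carrier G. \<exists>!w. w \<in> N \<and> word_val G w = g)"

definition nf :: "('a, 'm) monoid_scheme \<Rightarrow> 'a list set \<Rightarrow> 'a \<Rightarrow> 'a list" where
  "nf G N g = (THE w. w \<in> N \<and> word_val G w = g)"

definition cayley_edges :: "('a, 'm) monoid_scheme \<Rightarrow> 'a set \<Rightarrow> ('a \<times> 'a) set" where
  "cayley_edges G A = carrier G \<times> A"

definition degenerate_edges ::
    "('a, 'm) monoid_scheme \<Rightarrow> 'a set \<Rightarrow> 'a list set \<Rightarrow> ('a \<times> 'a) set" where
  "degenerate_edges G A N =
     {(g, a) \<in> cayley_edges G A.
        nf G N g @ [a] = nf G N (g \<otimes>\<^bsub>G\<^esub> a) \<or>
        nf G N g = nf G N (g \<otimes>\<^bsub>G\<^esub> a) @ [inv\<^bsub>G\<^esub> a]}"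

definition recursive_edges ::
    "('a, 'm) monoid_scheme \<Rightarrow> 'a set \<Rightarrow> 'a list set \<Rightarrow> ('a \<times> 'a) set" where
  "recursive_edges G A N = cayley_edges G A - degenerate_edges G A N"

primrec path_edges :: "('a, 'm) monoid_scheme \<Rightarrow> 'a \<Rightarrow> 'a list \<Rightarrow> ('a \<times> 'a) list" where
  "path_edges G g [] = []"
| "path_edges G g (a # w) = (g, a) # path_edges G (g \<otimes>\<^bsub>G\<^esub> a) w"

text \<open>\<open>(e', e) \<in> stacking_order G A N c\<close> is \<open>e' <\<^sub>c e\<close>.\<close>

definition stacking_order ::
    "('a, 'm) monoid_scheme \<Rightarrow> 'a set \<Rightarrow> 'a list set \<Rightarrow> ('a \<times> 'a \<Rightarrow> 'a list) \<Rightarrow>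
     (('a \<times> 'a) \<times> ('a \<times> 'a)) set" where
  "stacking_order G A N c =
     {(e', e). e' \<in> recursive_edges G A N \<and> e \<in> recursive_edges G A N \<and>
        e' \<in> set (path_edges G (fst e) (c e))}\<^sup>+"

text \<open>Values of \<open>c\<close> outside the recursive edges are irrelevant.\<close>

definition stacking ::
    "('a, 'm) monoid_scheme \<Rightarrow> 'a set \<Rightarrow> 'a list set \<Rightarrow> ('a \<times> 'a \<Rightarrow> 'a list) \<Rightarrow> bool" where
  "stacking G A N c \<longleftrightarrow>
     normal_forms G A N \<and>
     c \<in> recursive_edges G A N \<rightarrow> lists A \<and>
     nf G N \<one>\<^bsub>G\<^esub> = [] \<and>
     (\<forall>(g, a)\<in>recursive_edges G A N. word_val G (c (g, a)) = a) \<and>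
     irrefl (stacking_order G A N c) \<and> trans (stacking_order G A N c) \<and>
     (\<forall>e\<in>recursive_edges G A N.
        finite {e'' \<in> recursive_edges G A N. (e'', e) \<in> stacking_order G A N c}) \<and>
     finite (c ` recursive_edges G A N)"

definition stacking_triples ::
    "('a, 'm) monoid_scheme \<Rightarrow> 'a set \<Rightarrow> 'a list set \<Rightarrow> ('a \<times> 'a \<Rightarrow> 'a list) \<Rightarrow>
     ('a list \<times> 'a \<times> 'a list) set" where
  "stacking_triples G A N c =
     {(w, a, if (word_val G w, a) \<in> recursive_edges G A N then c (word_val G w, a) else [a])
       | w a. w \<in> lists A \<and> a \<in> A}"

definition regularly_stackable :: "('a, 'm) monoid_scheme \<Rightarrow> bool" where
  "regularly_stackable G \<longleftrightarrow>
     (\<exists>A N c. finite A \<and> symmetric_generating_set G A \<and> stacking G A N c \<and>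
        regular_language A N \<and> recursive_triples A (stacking_triples G A N c))"

end

theory Submission
  imports Defs "HOL-Library.Sublist"
begin

text \<open>
  Only irreducible letters occur in irreducible words, and distinct ones represent distinct
  nontrivial elements of the group. Take as generators \<open>B\<close> the nontrivial elements represented by
  letters, and their inverses; a generator that is not an irreducible letter is rewritten to its
  normal form by a rule of its own. The normal forms over \<open>B\<close> are then the words avoiding a finite
  set of factors, and replacing a forbidden factor \<open>u\<close> by its normal form \<open>y\<^sub>u\<close> terminates.

  If the edge \<open>e\<^bsub>g,a\<^esub>\<close> is recursive, then \<open>y\<^sub>g a\<close> ends in a forbidden factor \<open>u = u' a\<close>; put
  \<open>c(e\<^bsub>g,a\<^esub>) = u'\<^sup>- y\<^sub>u\<close>, where \<open>u'\<^sup>-\<close> is the formal inverse of \<open>u'\<close>. The path first runs back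
  along \<open>y\<^sub>g\<close> through degenerate edges; an edge \<open>e\<^bsub>h,b\<^esub>\<close> on the rest has \<open>y\<^sub>h b\<close> as a prefix of a
  proper reduct of \<open>y\<^sub>g a\<close>, whence well-foundedness. Both the leftmost reduction of a word and the
  choice of \<open>c\<close> only inspect bounded prefixes of a stack holding the reduced part in reverse,
  which makes the stacking recursive.
\<close>

section \<open>Closure properties of recursive functions\<close>

text \<open>A derivation of \<open>recursive_fun n\<close> pins a function down on lists of every
  length. Comparing values at length \<open>n\<close> only allows functions to be rewritten by
  equations valid for \<open>n\<close> arguments.\<close>

definition computable :: "nat \<Rightarrow> (nat list \<Rightarrow> nat) \<Rightarrow> bool" where
  "computable n f \<longleftrightarrow> (\<exists>f'. recursive_fun n f' \<and> (\<forall>xs. length xs = n \<longrightarrow> f' xs = f xs))"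

definition decidable :: "nat \<Rightarrow> (nat list \<Rightarrow> bool) \<Rightarrow> bool" where
  "decidable n P \<longleftrightarrow> computable n (\<lambda>xs. if P xs then 1 else 0)"

lemma computable_cong:
  assumes "computable n f" "\<And>xs. length xs = n \<Longrightarrow> f xs = g xs"
  shows "computable n g"
  using assms unfolding computable_def by metis

lemma computable_comp:
  assumes f: "computable (length gs) f" and gs: "\<And>g. g \<in> set gs \<Longrightarrow> computable n g"
  shows "computable n (\<lambda>xs. f (map (\<lambda>g. g xs) gs))"
proof -
  obtain f' where f': "recursive_fun (length gs) f'" "\<And>xs. length xs = length gs \<Longrightarrow> f' xs = f xs"
    using f unfolding computable_def by blast
  from gs obtain r where r: "\<And>g. g \<in> set gs \<Longrightarrow>
      recursive_fun n (r g) \<and> (\<forall>xs. length xs = n \<longrightarrow> r g xs = g xs)"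
    unfolding computable_def by metis
  have "recursive_fun n (\<lambda>xs. f' (map (\<lambda>g. g xs) (map r gs)))"
    by (rule recursive_fun.comp) (use f' r in auto)
  moreover have "f' (map (\<lambda>g. g xs) (map r gs)) = f (map (\<lambda>g. g xs) gs)" if "length xs = n" for xs
  proof -
    have "map (\<lambda>g. g xs) (map r gs) = map (\<lambda>g. g xs) gs" using r that by auto
    then show ?thesis using f'(2)[of "map (\<lambda>g. g xs) gs"] by (simp only: length_map)
  qed
  ultimately show ?thesis unfolding computable_def by blast
qed

lemma computable_nth: "i < n \<Longrightarrow> computable n (\<lambda>xs. xs ! i)"
  unfolding computable_def using recursive_fun.proj by blast

lemma computable_comp1:
  assumes "computable 1 (\<lambda>xs. h (xs ! 0))" "computable n g"
  shows "computable n (\<lambda>xs. h (g xs))"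
  using computable_comp[of "[g]" "\<lambda>xs. h (xs ! 0)" n] assms by simp

lemma computable_comp2:
  assumes "computable 2 (\<lambda>xs. h (xs ! 0) (xs ! 1))" "computable n g1" "computable n g2"
  shows "computable n (\<lambda>xs. h (g1 xs) (g2 xs))"
  using computable_comp[of "[g1, g2]" "\<lambda>xs. h (xs ! 0) (xs ! 1)" n] assms
  by (auto simp: numeral_2_eq_2)

lemma computable_comp3:
  assumes "computable 3 (\<lambda>xs. h (xs ! 0) (xs ! 1) (xs ! 2))"
    "computable n g1" "computable n g2" "computable n g3"
  shows "computable n (\<lambda>xs. h (g1 xs) (g2 xs) (g3 xs))"
  using computable_comp[of "[g1, g2, g3]" "\<lambda>xs. h (xs ! 0) (xs ! 1) (xs ! 2)" n] assms
  by (auto simp: numeral_3_eq_3)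

lemma computable_Suc:
  assumes "computable n g" shows "computable n (\<lambda>xs. Suc (g xs))"
proof -
  have "computable 1 (\<lambda>xs. Suc (xs ! 0))"
    unfolding computable_def using recursive_fun.succ by blast
  from computable_comp1[OF this assms] show ?thesis .
qed

lemma computable_const: "computable n (\<lambda>xs. k)"
proof (induction k)
  case 0
  show ?case unfolding computable_def using recursive_fun.zero by blast
next
  case (Suc k)
  then show ?case by (rule computable_Suc)
qed

lemma computable_rec_nat:
  assumes f: "computable n f" and g: "computable (Suc (Suc n)) g"
  shows "computable (Suc n) (\<lambda>xs. rec_nat (f (tl xs)) (\<lambda>k r. g (k # r # tl xs)) (hd xs))"
proof -
  obtain f' where f': "recursive_fun n f'" "\<And>xs. length xs = n \<Longrightarrow> f' xs = f xs"
    using f unfolding computable_def by blast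
  obtain g' where g': "recursive_fun (Suc (Suc n)) g'"
    "\<And>xs. length xs = Suc (Suc n) \<Longrightarrow> g' xs = g xs"
    using g unfolding computable_def by blast
  have "rec_nat (f' (tl xs)) (\<lambda>k r. g' (k # r # tl xs)) m =
      rec_nat (f (tl xs)) (\<lambda>k r. g (k # r # tl xs)) m" if "length xs = Suc n" for xs m
    by (induction m) (use that f' g' in auto)
  with recursive_fun.prim_rec[OF f'(1) g'(1)] show ?thesis
    unfolding computable_def by blast
qed

lemma computable_Least:
  assumes f: "computable (Suc n) f" and ex: "\<And>xs. length xs = n \<Longrightarrow> \<exists>k. f (k # xs) = 0"
  shows "computable n (\<lambda>xs. LEAST k. f (k # xs) = 0)"
proof -
  obtain f' where f': "recursive_fun (Suc n) f'" "\<And>xs. length xs = Suc n \<Longrightarrow> f' xs = f xs"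
    using f unfolding computable_def by blast
  have "recursive_fun n (\<lambda>xs. LEAST k. f' (k # xs) = 0)"
    by (rule recursive_fun.minimize) (use f' ex in auto)
  moreover have "(LEAST k. f' (k # xs) = 0) = (LEAST k. f (k # xs) = 0)" if "length xs = n" for xs
    using f'(2) that by simp
  ultimately show ?thesis unfolding computable_def by blast
qed

lemma length_SucE:
  assumes "length xs = Suc n" obtains y ys where "xs = y # ys" "length ys = n"
  using assms by (cases xs) auto

text \<open>Iteration is a primitive recursion whose step ignores the counter. Addition,
  subtraction, scanning a coded list and running a machine are all obtained as iterations.\<close>

lemma computable_funpow:
  assumes h: "computable 1 (\<lambda>xs. h (xs ! 0))" and k: "computable n k" and x: "computable n x"
  shows "computable n (\<lambda>xs. (h ^^ k xs) (x xs))"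
proof (rule computable_comp2[OF _ k x])
  have "computable (Suc (Suc (Suc 0))) (\<lambda>xs. h (xs ! 1))"
    by (rule computable_comp1[OF h computable_nth]) simp
  from computable_rec_nat[OF computable_nth[of 0] this]
  have "computable (Suc (Suc 0)) (\<lambda>xs. rec_nat (tl xs ! 0) (\<lambda>k r. h ((k # r # tl xs) ! 1)) (hd xs))"
    by simp
  moreover have "rec_nat y (\<lambda>k. h) m = (h ^^ m) y" for y m
    by (induction m) auto
  ultimately show "computable 2 (\<lambda>xs. (h ^^ (xs ! 0)) (xs ! 1))"
    by (auto simp: numeral_2_eq_2 intro: computable_cong elim!: length_SucE)
qed

lemma computable_if_zero:
  assumes "computable n c" "computable n y" "computable n z"
  shows "computable n (\<lambda>xs. if c xs = 0 then y xs else z xs)"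
proof (rule computable_comp3[where h="\<lambda>c y z. if c = 0 then y else z", OF _ assms])
  \<comment> \<open>A case distinction is a recursion on the condition: the base value is
    \<open>y\<close>, and the step discards the previous value and returns \<open>z\<close>, found
    at position 3 behind the counter, the previous value and \<open>y\<close>.\<close>
  have "computable (Suc (Suc (Suc 0))) (\<lambda>xs. rec_nat (tl xs ! 0) (\<lambda>k r. (k # r # tl xs) ! 3) (hd xs))"
    by (rule computable_rec_nat[OF computable_nth computable_nth]) auto
  moreover have "rec_nat y (\<lambda>_ _. z) m = (if m = 0 then y else z)" for y z m :: nat
    by (cases m) auto
  ultimately show "computable 3 (\<lambda>xs. if xs ! 0 = 0 then xs ! 1 else xs ! 2)"
    by (auto simp: numeral_3_eq_3 numeral_2_eq_2 intro: computable_cong elim!: length_SucE)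
qed

lemma computable_if:
  assumes "decidable n P" "computable n y" "computable n z"
  shows "computable n (\<lambda>xs. if P xs then y xs else z xs)"
  by (rule computable_cong[OF computable_if_zero[OF assms(1)[unfolded decidable_def] assms(3,2)]]) auto

lemma decidable_if:
  assumes "decidable n P" "decidable n Q" "decidable n S"
  shows "decidable n (\<lambda>xs. if P xs then Q xs else S xs)"
  unfolding decidable_def
  by (rule computable_cong[OF computable_if[OF assms[unfolded decidable_def[of _ Q] decidable_def[of _ S]]]]) auto

lemma decidable_const: "decidable n (\<lambda>_. b)"
  by (cases b) (simp_all add: decidable_def computable_const)

lemma decidable_not:
  assumes "decidable n P" shows "decidable n (\<lambda>xs. \<not> P xs)"
  using decidable_if[OF assms decidable_const[of n False] decidable_const[of n True]]
  by (rule back_subst[of "decidable n"]) (auto simp: fun_eq_iff)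

lemma decidable_conj:
  assumes "decidable n P" "decidable n Q" shows "decidable n (\<lambda>xs. P xs \<and> Q xs)"
  using decidable_if[OF assms decidable_const[of n False]]
  by (rule back_subst[of "decidable n"]) (auto simp: fun_eq_iff)

lemma decidable_eq_0: "computable n f \<Longrightarrow> decidable n (\<lambda>xs. f xs = 0)"
  unfolding decidable_def by (intro computable_if_zero computable_const)

lemma computable_add:
  assumes "computable n f" "computable n g" shows "computable n (\<lambda>xs. f xs + g xs)"
proof -
  have "computable n (\<lambda>xs. (Suc ^^ f xs) (g xs))"
    by (intro computable_funpow computable_Suc computable_nth assms) simp
  moreover have "(Suc ^^ k) m = k + m" for k m by (induction k) auto
  ultimately show ?thesis by simp
qed

lemma computable_pred:
  assumes "computable n g" shows "computable n (\<lambda>xs. g xs - 1)"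
proof (rule computable_comp1[OF _ assms])
  have "computable (Suc 0) (\<lambda>xs. rec_nat 0 (\<lambda>k r. (k # r # tl xs) ! 0) (hd xs))"
    by (rule computable_rec_nat[OF computable_const computable_nth]) auto
  moreover have "rec_nat 0 (\<lambda>k _. k) m = m - 1" for m :: nat
    by (cases m) auto
  ultimately show "computable 1 (\<lambda>xs. xs ! 0 - 1)"
    by (auto intro: computable_cong elim!: length_SucE)
qed

lemma computable_diff:
  assumes "computable n f" "computable n g" shows "computable n (\<lambda>xs. f xs - g xs)"
proof -
  have "computable n (\<lambda>xs. ((\<lambda>m. m - 1) ^^ g xs) (f xs))"
    by (intro computable_funpow computable_pred computable_nth assms) simp
  moreover have "((\<lambda>m. m - 1) ^^ k) m = m - k" for k m :: nat by (induction k) auto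
  ultimately show ?thesis by simp
qed

lemma decidable_less:
  assumes "computable n f" "computable n g" shows "decidable n (\<lambda>xs. f xs < g xs)"
  using decidable_not[OF decidable_eq_0[OF computable_diff[OF assms(2,1)]]]
  by (simp add: not_le)

lemma decidable_eq:
  assumes "computable n f" "computable n g" shows "decidable n (\<lambda>xs. f xs = g xs)"
  using decidable_conj[OF decidable_not[OF decidable_less[OF assms]]
      decidable_not[OF decidable_less[OF assms(2,1)]]]
  by (simp add: not_less eq_iff conj_commute)

section \<open>The Cantor pairing function and its inverse\<close>

lemma computable_triangle:
  assumes "computable n g" shows "computable n (\<lambda>xs. triangle (g xs))"
proof (rule computable_comp1[OF _ assms])
  have "computable (Suc (Suc 0)) (\<lambda>xs. xs ! 1 + Suc (xs ! 0))"
    by (intro computable_add computable_Suc computable_nth) auto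
  from computable_rec_nat[OF computable_const this, of 0]
  have "computable (Suc 0) (\<lambda>xs. rec_nat 0 (\<lambda>k r. r + Suc k) (hd xs))" by simp
  moreover have "rec_nat 0 (\<lambda>k r. r + Suc k) m = triangle m" for m
    by (induction m) auto
  ultimately show "computable 1 (\<lambda>xs. triangle (xs ! 0))"
    by (auto intro: computable_cong elim!: length_SucE)
qed

lemma computable_prod_encode:
  assumes "computable n f" "computable n g"
  shows "computable n (\<lambda>xs. prod_encode (f xs, g xs))"
  unfolding prod_encode_def
  by (simp, intro computable_add computable_triangle assms)

lemma triangle_mono: "m \<le> n \<Longrightarrow> triangle m \<le> triangle n"
  by (rule lift_Suc_mono_le[of triangle]) auto

text \<open>The code of \<open>(a, b)\<close> is \<open>triangle (a + b) + a\<close>, so the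
  diagonal \<open>a + b\<close> is the least \<open>d\<close> with
  \<open>m < triangle (Suc d)\<close>; truncated subtraction turns this bound into a zero to be
  found by minimization.\<close>

lemma prod_decode_conv_Least:
  defines "d \<equiv> \<lambda>m. LEAST d. Suc m - triangle (Suc d) = 0"
  shows "prod_decode m = (m - triangle (d m), d m - (m - triangle (d m)))"
proof -
  obtain a b where ab: "prod_decode m = (a, b)" by force
  then have m: "m = triangle (a + b) + a"
    using prod_decode_inverse[of m] by (simp add: prod_encode_def)
  have "d m = a + b"
    unfolding d_def
  proof (rule Least_equality)
    fix y assume y: "Suc m - triangle (Suc y) = 0"
    show "a + b \<le> y"
    proof (rule ccontr)
      assume "\<not> a + b \<le> y"
      then have "triangle (Suc y) \<le> triangle (a + b)" by (intro triangle_mono) auto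
      then show False using y m by linarith
    qed
  qed (simp add: m)
  then show ?thesis using m ab by (simp del: prod_decode_triangle_add)
qed

lemma computable_prod_decode:
  assumes "computable n g"
  shows "computable n (\<lambda>xs. fst (prod_decode (g xs)))" "computable n (\<lambda>xs. snd (prod_decode (g xs)))"
proof -
  let ?d = "\<lambda>m. LEAST d. Suc m - triangle (Suc d) = 0"
  have "computable 1 (\<lambda>xs. LEAST d. Suc ((d # xs) ! 1) - triangle (Suc ((d # xs) ! 0)) = 0)"
  proof (rule computable_Least)
    show "computable (Suc 1) (\<lambda>xs. Suc (xs ! 1) - triangle (Suc (xs ! 0)))"
      by (intro computable_diff computable_Suc computable_triangle computable_nth) auto
    fix xs :: "nat list"
    show "\<exists>k. Suc ((k # xs) ! 1) - triangle (Suc ((k # xs) ! 0)) = 0"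
      by (rule exI[of _ "xs ! 0"]) simp
  qed
  then have d: "computable n (\<lambda>xs. ?d (g xs))"
    using computable_comp1[of ?d, OF _ assms] by simp
  show "computable n (\<lambda>xs. fst (prod_decode (g xs)))"
    unfolding prod_decode_conv_Least fst_conv
    by (intro computable_diff computable_triangle assms d)
  show "computable n (\<lambda>xs. snd (prod_decode (g xs)))"
    unfolding prod_decode_conv_Least snd_conv
    by (intro computable_diff computable_triangle assms d)
qed

section \<open>Lists of numbers coded as numbers\<close>

definition code_hd :: "nat \<Rightarrow> nat" where "code_hd c = fst (prod_decode (c - 1))"
definition code_tl :: "nat \<Rightarrow> nat" where "code_tl c = snd (prod_decode (c - 1))"

text \<open>Truncated \<open>0 - 1\<close> is \<open>0\<close>, which decodes to the pair
  \<open>(0, 0)\<close>; so \<open>code_tl\<close> agrees with \<open>tl\<close> on the empty list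
  as well.\<close>

lemma code_tl_0 [simp]: "code_tl 0 = 0"
proof -
  have "prod_decode 0 = (0, 0)" using prod_encode_inverse[of "(0, 0)"] by (simp add: prod_encode_def)
  then show ?thesis by (simp add: code_tl_def)
qed

lemma code_hd_tl_Cons [simp]:
  "code_hd (list_encode (x # xs)) = x" "code_tl (list_encode (x # xs)) = list_encode xs"
  by (simp_all add: code_hd_def code_tl_def)

lemma list_encode_eq_0 [simp]: "list_encode xs = 0 \<longleftrightarrow> xs = []"
  by (cases xs) auto

lemma computable_code_hd: "computable n g \<Longrightarrow> computable n (\<lambda>xs. code_hd (g xs))"
  unfolding code_hd_def by (intro computable_prod_decode computable_pred)

lemma computable_code_tl: "computable n g \<Longrightarrow> computable n (\<lambda>xs. code_tl (g xs))"
  unfolding code_tl_def by (intro computable_prod_decode computable_pred)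

text \<open>Computability of functions into lists is computability of the coded value.\<close>

lemma computable_list_decode:
  "computable n g \<Longrightarrow> computable n (\<lambda>xs. list_encode (list_decode (g xs)))"
  by simp

lemma decidable_Nil:
  "computable n (\<lambda>xs. list_encode (f xs)) \<Longrightarrow> decidable n (\<lambda>xs. f xs = [])"
  using decidable_eq_0[of n "\<lambda>xs. list_encode (f xs)"] by simp

text \<open>The value of \<open>hd []\<close> is unspecified, so a default is needed; every use
  guards against the empty list.\<close>

lemma computable_hd:
  assumes "computable n (\<lambda>xs. list_encode (f xs))"
  shows "computable n (\<lambda>xs. if f xs = [] then 0 else hd (f xs))"
proof -
  have *: "(if l = [] then 0 else code_hd (list_encode l)) = (if l = [] then 0 else hd l)" for l
    by (cases l) (auto simp del: list_encode.simps)
  have "computable n (\<lambda>xs. if f xs = [] then 0 else code_hd (list_encode (f xs)))"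
    by (intro computable_if decidable_Nil assms computable_code_hd computable_const)
  then show ?thesis unfolding * .
qed

lemma computable_tl:
  assumes "computable n (\<lambda>xs. list_encode (f xs))"
  shows "computable n (\<lambda>xs. list_encode (tl (f xs)))"
proof -
  have *: "code_tl (list_encode l) = list_encode (tl l)" for l
    by (cases l) (simp, simp del: list_encode.simps)
  show ?thesis using computable_code_tl[OF assms] by (simp add: *)
qed

lemma computable_drop:
  assumes "computable n (\<lambda>xs. list_encode (f xs))"
  shows "computable n (\<lambda>xs. list_encode (drop k (f xs)))"
proof (induction k)
  case (Suc k)
  then show ?case using computable_tl[OF Suc] by (simp add: drop_Suc drop_tl)
qed (simp add: assms)

lemma computable_Cons:
  assumes "computable n g" "computable n (\<lambda>xs. list_encode (f xs))"
  shows "computable n (\<lambda>xs. list_encode (g xs # f xs))"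
  by (simp, intro computable_Suc computable_prod_encode assms)

lemma computable_append:
  assumes "computable n (\<lambda>xs. list_encode (f xs))"
  shows "computable n (\<lambda>xs. list_encode (v @ f xs))"
proof (induction v)
  case (Cons a v)
  show ?case using computable_Cons[OF computable_const[of n a] Cons] by simp
qed (simp add: assms)

lemma decidable_prefix:
  assumes "computable n (\<lambda>xs. list_encode (f xs))"
  shows "decidable n (\<lambda>xs. prefix p (f xs))"
  using assms
proof (induction p arbitrary: f)
  case Nil
  show ?case by (simp add: decidable_const)
next
  case (Cons a p)
  have *: "prefix (a # p) l \<longleftrightarrow> l \<noteq> [] \<and> (if l = [] then 0 else hd l) = a \<and> prefix p (tl l)" for l
    by (cases l) auto
  show ?case unfolding *
    by (intro decidable_conj decidable_not decidable_Nil decidable_eq computable_hd computable_const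
        Cons.IH computable_tl Cons.prems)
qed

lemma length_le_list_encode: "length xs \<le> list_encode xs"
proof (induction xs)
  case (Cons x xs)
  show ?case using Cons le_prod_encode_2[of "list_encode xs" x] by simp
qed simp

text \<open>The function \<open>h\<close> removes a head smaller than \<open>k\<close> and leaves
  every other code unchanged, so repeated application reaches \<open>0\<close> exactly when all
  letters are smaller than \<open>k\<close>. The code itself serves as the number of iterations,
  because it bounds the length.\<close>

lemma decidable_lists_lessThan:
  assumes "computable n g"
  shows "decidable n (\<lambda>xs. list_decode (g xs) \<in> lists {..<k})"
proof -
  define h where "h = (\<lambda>c. if c \<noteq> 0 \<and> code_hd c < k then code_tl c else c)"
  have *: "(h ^^ m) (list_encode l) = 0 \<longleftrightarrow> l \<in> lists {..<k}" if "length l \<le> m" for m l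
    using that
  proof (induction m arbitrary: l)
    case (Suc m)
    show ?case
    proof (cases l)
      case Nil
      have "(h ^^ m) 0 = 0" for m by (induction m) (auto simp: h_def)
      then show ?thesis using Nil by (auto simp: h_def simp del: funpow.simps)
    next
      case (Cons a l')
      show ?thesis
      proof (cases "a < k")
        case True
        then have "h (list_encode l) = list_encode l'"
          unfolding Cons h_def code_hd_tl_Cons by simp
        then show ?thesis using Suc True Cons
          by (simp add: funpow_Suc_right del: funpow.simps)
      next
        case False
        then have "h (list_encode l) = list_encode l"
          unfolding Cons h_def code_hd_tl_Cons by simp
        then have "(h ^^ m) (list_encode l) = list_encode l" for m
          by (induction m) auto
        then show ?thesis using False Cons by (simp del: funpow.simps)
      qed
    qed
  qed simp
  have "computable 1 (\<lambda>xs. h (xs ! 0))"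
    unfolding h_def
    by (intro computable_if decidable_conj decidable_not decidable_eq_0
        decidable_less computable_const computable_code_hd computable_code_tl computable_nth) auto
  then have "decidable n (\<lambda>xs. (h ^^ g xs) (g xs) = 0)"
    by (intro decidable_eq_0 computable_funpow assms)
  moreover have "(h ^^ c) c = 0 \<longleftrightarrow> list_decode c \<in> lists {..<k}" for c
    using *[of "list_decode c" c] length_le_list_encode[of "list_decode c"] by simp
  ultimately show ?thesis by simp
qed

section \<open>Stack machines on coded words\<close>

definition lookup :: "('x list \<times> 'y) list \<Rightarrow> 'x list \<Rightarrow> ('x list \<times> 'y) option" where
  "lookup rs t = find (\<lambda>(p, _). prefix p t) rs"

text \<open>A configuration consists of the processed part in reverse, top of the stack first, and
  the remaining input. A pattern is sought at the top once the next letter is pushed, and its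
  replacement goes back to the input, since it may create new matches. Configurations with empty
  input are fixed.\<close>

definition stack_step :: "('x list \<times> 'x list) list \<Rightarrow> 'x list \<times> 'x list \<Rightarrow> 'x list \<times> 'x list" where
  "stack_step rs = (\<lambda>(s, i). if i = [] then (s, i) else
     case lookup rs (hd i # s) of
       None \<Rightarrow> (hd i # s, tl i)
     | Some (p, v) \<Rightarrow> (drop (length p) (hd i # s), v @ tl i))"

definition stack_run :: "('x list \<times> 'x list) list \<Rightarrow> 'x list \<Rightarrow> 'x list" where
  "stack_run rs w =
     fst ((stack_step rs ^^ (LEAST k. snd ((stack_step rs ^^ k) ([], w)) = [])) ([], w))"

lemma lookup_simps [simp]:
  "lookup [] t = None"
  "lookup ((p, v) # rs) t = (if prefix p t then Some (p, v) else lookup rs t)"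
  by (simp_all add: lookup_def)

fun conf_encode :: "nat list \<times> nat list \<Rightarrow> nat" where
  "conf_encode (s, i) = prod_encode (list_encode s, list_encode i)"

definition conf_decode :: "nat \<Rightarrow> nat list \<times> nat list" where
  "conf_decode m = (list_decode (fst (prod_decode m)), list_decode (snd (prod_decode m)))"

lemma conf_decode_encode [simp]: "conf_decode (conf_encode c) = c"
  by (cases c) (simp add: conf_decode_def)

lemma snd_conf_encode [simp]: "snd (prod_decode (conf_encode c)) = list_encode (snd c)"
  by (cases c) simp

lemma fst_conf_encode [simp]: "fst (prod_decode (conf_encode c)) = list_encode (fst c)"
  by (cases c) simp

text \<open>The rules are a fixed list and not an input, so the lookup unfolds into a finite cascade
  of prefix tests. The default letter \<open>0\<close> in \<open>t\<close> arises only for empty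
  input, where the step is the identity.\<close>

lemma computable_stack_step: "computable 1 (\<lambda>xs. conf_encode (stack_step rs (conf_decode (xs ! 0))))"
proof -
  define s where "s = (\<lambda>xs :: nat list. list_decode (fst (prod_decode (xs ! 0))))"
  define i where "i = (\<lambda>xs :: nat list. list_decode (snd (prod_decode (xs ! 0))))"
  have s: "computable 1 (\<lambda>xs. list_encode (s xs))" and i: "computable 1 (\<lambda>xs. list_encode (i xs))"
    unfolding s_def i_def
    by (intro computable_list_decode computable_prod_decode computable_nth; simp)+
  define t where "t = (\<lambda>xs. (if i xs = [] then 0 else hd (i xs)) # s xs)"
  have t: "computable 1 (\<lambda>xs. list_encode (t xs))"
    unfolding t_def by (intro computable_Cons computable_hd s i)
  have "computable 1 (\<lambda>xs. case lookup rs (t xs) of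
       None \<Rightarrow> prod_encode (list_encode (t xs), list_encode (tl (i xs)))
     | Some (p, v) \<Rightarrow> prod_encode (list_encode (drop (length p) (t xs)), list_encode (v @ tl (i xs))))"
    (is "computable 1 (?F rs)")
  proof (induction rs)
    case Nil
    show ?case unfolding lookup_simps option.case by (intro computable_prod_encode t computable_tl i)
  next
    case (Cons r rs)
    obtain p v where r: "r = (p, v)" by force
    have "computable 1 (\<lambda>xs. if prefix p (t xs) then prod_encode (list_encode (drop (length p) (t xs)),
        list_encode (v @ tl (i xs))) else ?F rs xs)"
      by (intro computable_if decidable_prefix computable_prod_encode computable_drop
          computable_append computable_tl t i Cons)
    then show ?case by (rule back_subst[of "computable 1"]) (simp add: r fun_eq_iff)
  qed
  then have "computable 1 (\<lambda>xs. if i xs = [] then prod_encode (list_encode (s xs), list_encode (i xs)) else ?F rs xs)"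
    by (intro computable_if decidable_Nil computable_prod_encode s i)
  then show ?thesis
    by (rule back_subst[of "computable 1"])
      (auto simp: fun_eq_iff stack_step_def conf_decode_def s_def i_def t_def split: option.split)
qed

text \<open>Minimization requires a zero for every argument, whereas halting is known only for words
  over \<open>{..<k}\<close>; every other word is therefore replaced by \<open>[]\<close> before the
  run.\<close>

lemma computable_stack_run:
  assumes halt: "\<And>w. w \<in> lists {..<k} \<Longrightarrow> \<exists>m. snd ((stack_step rs ^^ m) ([], w)) = []"
    and g: "computable n g"
  shows "computable n (\<lambda>xs. if list_decode (g xs) \<in> lists {..<k}
    then list_encode (stack_run rs (list_decode (g xs))) else 0)"
proof -
  define c where "c = (\<lambda>W. if list_decode W \<in> lists {..<k} then list_decode W else [])"
  have c: "computable n (\<lambda>xs. list_encode (c (g xs)))" if "computable n g" for n g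
  proof -
    have "computable n (\<lambda>xs. if list_decode (g xs) \<in> lists {..<k} then g xs else list_encode [])"
      using that by (intro computable_if decidable_lists_lessThan computable_const)
    then show ?thesis by (rule back_subst[of "computable n"]) (auto simp: c_def)
  qed
  \<comment> \<open>The machine step on codes. Its iterates are the codes of the iterated
    configurations, so the halting time is the first zero of the coded input component.\<close>
  define h where "h = (\<lambda>m. conf_encode (stack_step rs (conf_decode m)))"
  have h: "(h ^^ m) (conf_encode x) = conf_encode ((stack_step rs ^^ m) x)" for m x
    by (induction m) (auto simp: h_def)
  define P where "P = (\<lambda>m W. (h ^^ m) (conf_encode ([], c W)))"
  have P: "P m W = conf_encode ((stack_step rs ^^ m) ([], c W))" for m W
    unfolding P_def h ..
  have cP: "computable n (\<lambda>xs. P (f xs) (g xs))" if "computable n f" "computable n g" for n f g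
    unfolding P_def conf_encode.simps
    using that computable_stack_step computable_const
    by (intro computable_funpow computable_prod_encode c) (simp_all add: h_def)
  have "computable 1 (\<lambda>xs. LEAST m. snd (prod_decode (P ((m # xs) ! 0) ((m # xs) ! 1))) = 0)"
  proof (rule computable_Least)
    show "computable (Suc 1) (\<lambda>xs. snd (prod_decode (P (xs ! 0) (xs ! 1))))"
      by (intro computable_prod_decode cP computable_nth) auto
    fix xs :: "nat list"
    have "c (xs ! 0) \<in> lists {..<k}" by (auto simp: c_def)
    then show "\<exists>m. snd (prod_decode (P ((m # xs) ! 0) ((m # xs) ! 1))) = 0"
      using halt by (simp add: P)
  qed
  then have 1: "computable 1 (\<lambda>xs. LEAST m. snd (prod_decode (P m (xs ! 0))) = 0)" by simp
  have "computable n (\<lambda>xs. LEAST m. snd (prod_decode (P m (g xs))) = 0)"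
    using computable_comp1[of "\<lambda>W. LEAST m. snd (prod_decode (P m W)) = 0", OF 1 g] .
  then have "computable n (\<lambda>xs. if list_decode (g xs) \<in> lists {..<k} then
       fst (prod_decode (P (LEAST m. snd (prod_decode (P m (g xs))) = 0) (g xs))) else 0)"
    by (intro computable_if decidable_lists_lessThan computable_const g computable_prod_decode cP)
  then show ?thesis
    by (rule back_subst[of "computable n"]) (auto simp: P c_def stack_run_def)
qed

lemma computable_lookup:
  assumes t: "computable n (\<lambda>xs. list_encode (t xs))" and d: "computable n (\<lambda>xs. list_encode (d xs))"
  shows "computable n (\<lambda>xs. list_encode (case lookup cs (t xs) of None \<Rightarrow> d xs | Some (p, v) \<Rightarrow> v))"
proof (induction cs)
  case Nil
  show ?case by (simp add: d)
next
  case (Cons r rs)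
  obtain p v where r: "r = (p, v)" by force
  have "computable n (\<lambda>xs. if prefix p (t xs) then list_encode v
      else list_encode (case lookup rs (t xs) of None \<Rightarrow> d xs | Some (p, v) \<Rightarrow> v))"
    by (intro computable_if decidable_prefix computable_const t Cons)
  then show ?case by (rule back_subst[of "computable n"]) (simp add: r fun_eq_iff)
qed

text \<open>Every number codes a list, so membership amounts to checking the letters and comparing
  the third component with the value computed from the first two.\<close>

theorem recursive_stack_lookup:
  assumes halt: "\<And>w. w \<in> lists {..<k} \<Longrightarrow> \<exists>m. snd ((stack_step rs ^^ m) ([], w)) = []"
  shows "recursive_relation 3 {[list_encode w, a, list_encode
      (case lookup cs (a # stack_run rs w) of None \<Rightarrow> [a] | Some (p, v) \<Rightarrow> v)] | w a.
      w \<in> lists {..<k} \<and> a < k}" (is "recursive_relation 3 ?S")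
proof -
  define s where "s = (\<lambda>xs. if list_decode (xs ! 0) \<in> lists {..<k}
    then stack_run rs (list_decode (xs ! 0)) else [])"
  have "computable 3 (\<lambda>xs. if list_decode (xs ! 0) \<in> lists {..<k}
    then list_encode (stack_run rs (list_decode (xs ! 0))) else 0)"
    by (intro computable_stack_run halt computable_nth) auto
  then have s: "computable 3 (\<lambda>xs. list_encode (s xs))"
    by (rule back_subst[of "computable 3"]) (auto simp: s_def)
  \<comment> \<open>\<open>list_decode 0\<close> is the empty list, so the default is
    \<open>[a]\<close>, written in the form that \<open>computable_list_decode\<close>
    covers.\<close>
  define C where "C = (\<lambda>xs. list_encode
      (case lookup cs (xs ! 1 # s xs) of None \<Rightarrow> xs ! 1 # list_decode 0 | Some (p, v) \<Rightarrow> v))"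
  have C: "computable 3 C"
    unfolding C_def
    by (intro computable_lookup computable_Cons computable_list_decode s computable_nth computable_const) auto
  have "decidable 3 (\<lambda>xs. list_decode (xs ! 0) \<in> lists {..<k} \<and> xs ! 1 < k \<and> xs ! 2 = C xs)"
    by (intro decidable_conj decidable_lists_lessThan decidable_less decidable_eq C computable_nth
        computable_const) auto
  moreover have "(list_decode (xs ! 0) \<in> lists {..<k} \<and> xs ! 1 < k \<and> xs ! 2 = C xs) \<longleftrightarrow> xs \<in> ?S"
    if len: "length xs = 3" for xs
  proof -
    obtain W a X where xs: "xs = [W, a, X]"
      using len by (auto simp: numeral_3_eq_3 length_Suc_conv)
    show ?thesis unfolding xs
      by (auto simp: C_def s_def intro!: exI[of _ "list_decode W"] split: option.split)
  qed
  ultimately show ?thesis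
    unfolding decidable_def computable_def recursive_relation_def by auto
qed

lemma lookup_SomeD: "lookup rs t = Some (p, v) \<Longrightarrow> (p, v) \<in> set rs \<and> prefix p t"
  by (induction rs) (auto split: if_splits)

lemma lookup_eq_None: "lookup rs t = None \<longleftrightarrow> (\<forall>(p, v) \<in> set rs. \<not> prefix p t)"
  by (induction rs) (auto split: if_splits)

section \<open>Renaming the letters of a stack machine\<close>

lemma prefix_map_inj:
  assumes "inj_on f X" "p \<in> lists X" "t \<in> lists X"
  shows "prefix (map f p) (map f t) \<longleftrightarrow> prefix p t"
  using assms
proof (induction p arbitrary: t)
  case (Cons a p)
  then show ?case by (cases t) (auto dest: inj_onD)
qed simp

lemma lookup_map:
  assumes "inj_on f X" "set rs \<subseteq> lists X \<times> lists X" "t \<in> lists X"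
  shows "lookup (map (\<lambda>(p, v). (map f p, map f v)) rs) (map f t) =
    map_option (\<lambda>(p, v). (map f p, map f v)) (lookup rs t)"
  using assms(2)
proof (induction rs)
  case (Cons r rs)
  obtain p v where r: "r = (p, v)" by force
  with Cons.prems have "p \<in> lists X" by auto
  from prefix_map_inj[OF assms(1) this assms(3)] show ?case using Cons r by auto
qed simp

lemma stack_step_map:
  assumes f: "inj_on f X" and rs: "set rs \<subseteq> lists X \<times> lists X"
    and si: "s \<in> lists X" "i \<in> lists X"
  shows "stack_step (map (\<lambda>(p, v). (map f p, map f v)) rs) (map f s, map f i) =
      map_prod (map f) (map f) (stack_step rs (s, i))"
    "fst (stack_step rs (s, i)) \<in> lists X" "snd (stack_step rs (s, i)) \<in> lists X"
proof -
  have "stack_step (map (\<lambda>(p, v). (map f p, map f v)) rs) (map f s, map f i) =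
      map_prod (map f) (map f) (stack_step rs (s, i)) \<and>
    fst (stack_step rs (s, i)) \<in> lists X \<and> snd (stack_step rs (s, i)) \<in> lists X"
  proof (cases i)
    case Nil
    then show ?thesis using si by (simp add: stack_step_def)
  next
    case (Cons a i')
    have eq: "lookup (map (\<lambda>(p, v). (map f p, map f v)) rs) (f a # map f s) =
      map_option (\<lambda>(p, v). (map f p, map f v)) (lookup rs (a # s))"
      using lookup_map[OF f, of rs "a # s"] rs si Cons by simp
    show ?thesis
    proof (cases "lookup rs (a # s)")
      case None
      then show ?thesis using eq si Cons by (simp add: stack_step_def)
    next
      case (Some r)
      obtain p v where r: "r = (p, v)" by force
      have "v \<in> lists X" using lookup_SomeD[of rs "a # s" p v] Some rs r by auto
      moreover have "a # s \<in> lists X" using si Cons by simp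
      then have "drop (length p) (a # s) \<in> lists X"
        unfolding in_lists_conv_set by (meson in_set_dropD)
      moreover have "drop (length p) (f a # map f s) = map f (drop (length p) (a # s))"
        using drop_map[of "length p" f "a # s"] by simp
      ultimately show ?thesis using eq si Cons Some r by (simp add: stack_step_def)
    qed
  qed
  then show "stack_step (map (\<lambda>(p, v). (map f p, map f v)) rs) (map f s, map f i) =
      map_prod (map f) (map f) (stack_step rs (s, i))"
    "fst (stack_step rs (s, i)) \<in> lists X" "snd (stack_step rs (s, i)) \<in> lists X"
    by auto
qed

lemma stack_steps_map:
  assumes "inj_on f X" "set rs \<subseteq> lists X \<times> lists X" "w \<in> lists X"
  shows "(stack_step (map (\<lambda>(p, v). (map f p, map f v)) rs) ^^ m) ([], map f w) =
      map_prod (map f) (map f) ((stack_step rs ^^ m) ([], w)) \<and>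
    (stack_step rs ^^ m) ([], w) \<in> lists X \<times> lists X"
proof (induction m)
  case 0
  then show ?case using assms(3) by simp
next
  case (Suc m)
  obtain s i where si: "(stack_step rs ^^ m) ([], w) = (s, i)" by force
  then have "s \<in> lists X" "i \<in> lists X" using Suc by auto
  from stack_step_map[OF assms(1,2) this] show ?case
    using Suc si by (auto simp: mem_Times_iff)
qed

lemma stack_run_map:
  assumes "inj_on f X" "set rs \<subseteq> lists X \<times> lists X" "w \<in> lists X"
  shows "stack_run (map (\<lambda>(p, v). (map f p, map f v)) rs) (map f w) = map f (stack_run rs w)"
    "stack_run rs w \<in> lists X"
  using stack_steps_map[OF assms] unfolding stack_run_def by (auto simp: mem_Times_iff)

text \<open>A numbering of \<open>B\<close> maps the words over \<open>B\<close> onto the words over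
  \<open>{..<card B}\<close> and commutes with lookups and machine steps, so the result for numbers
  carries over.\<close>

theorem recursive_triples_stack_lookup:
  assumes fin: "finite B"
    and rs: "set rs \<subseteq> lists B \<times> lists B"
    and cs: "set cs \<subseteq> lists B \<times> lists B"
    and halt: "\<And>w. w \<in> lists B \<Longrightarrow> \<exists>m. snd ((stack_step rs ^^ m) ([], w)) = []"
  shows "recursive_triples B {(w, a, case lookup cs (a # stack_run rs w) of
      None \<Rightarrow> [a] | Some (p, v) \<Rightarrow> v) | w a. w \<in> lists B \<and> a \<in> B}"
proof -
  obtain \<iota> where \<iota>: "bij_betw \<iota> B {..<card B}"
    using ex_bij_betw_finite_nat[OF fin] by (auto simp: atLeast0LessThan)
  then have inj: "inj_on \<iota> B" and img: "\<iota> ` B = {..<card B}" by (auto simp: bij_betw_def)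
  let ?m = "\<lambda>rs. map (\<lambda>(p, v). (map \<iota> p, map \<iota> v)) rs"
  have ex: "\<exists>w\<in>lists B. v = map \<iota> w" if "v \<in> lists {..<card B}" for v
    using that unfolding img[symmetric] lists_image by auto
  have halt': "\<exists>m. snd ((stack_step (?m rs) ^^ m) ([], v)) = []" if "v \<in> lists {..<card B}" for v
  proof -
    obtain w where w: "w \<in> lists B" "v = map \<iota> w" using ex[OF \<open>v \<in> _\<close>] by blast
    from halt[OF w(1)] obtain m where "snd ((stack_step rs ^^ m) ([], w)) = []" ..
    then have "snd ((stack_step (?m rs) ^^ m) ([], v)) = []"
      using stack_steps_map[OF inj rs w(1), of m] w(2) by simp
    then show ?thesis ..
  qed
  have val: "(case lookup (?m cs) (\<iota> a # stack_run (?m rs) (map \<iota> w)) of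
        None \<Rightarrow> [\<iota> a] | Some (p, v) \<Rightarrow> v) =
      map \<iota> (case lookup cs (a # stack_run rs w) of None \<Rightarrow> [a] | Some (p, v) \<Rightarrow> v)"
    if "w \<in> lists B" "a \<in> B" for w a
  proof -
    have "a # stack_run rs w \<in> lists B" using stack_run_map(2)[OF inj rs that(1)] that(2) by simp
    from lookup_map[OF inj _ this, of cs] cs show ?thesis
      using stack_run_map(1)[OF inj rs that(1)] by (auto split: option.split)
  qed
  have "{[list_encode v, b, list_encode (case lookup (?m cs) (b # stack_run (?m rs) v) of
        None \<Rightarrow> [b] | Some (p, v) \<Rightarrow> v)] | v b. v \<in> lists {..<card B} \<and> b < card B} =
      {[list_encode (map \<iota> w), \<iota> a, list_encode (map \<iota> x)] | w a x. (w, a, x) \<in>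
        {(w, a, case lookup cs (a # stack_run rs w) of None \<Rightarrow> [a] | Some (p, v) \<Rightarrow> v) | w a.
          w \<in> lists B \<and> a \<in> B}}" (is "?L = ?R")
  proof
    show "?L \<subseteq> ?R"
    proof
      fix x assume "x \<in> ?L"
      then obtain v b where x: "x = [list_encode v, b, list_encode (case lookup (?m cs)
          (b # stack_run (?m rs) v) of None \<Rightarrow> [b] | Some (p, v) \<Rightarrow> v)]"
        and "v \<in> lists {..<card B}" "b < card B" by blast
      then obtain w a where wa: "w \<in> lists B" "a \<in> B" and vb: "v = map \<iota> w" "b = \<iota> a"
        using ex img by (metis imageE lessThan_iff)
      have "x = [list_encode (map \<iota> w), \<iota> a, list_encode (map \<iota>
          (case lookup cs (a # stack_run rs w) of None \<Rightarrow> [a] | Some (p, v) \<Rightarrow> v))]"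
        unfolding x vb val[OF wa] ..
      then show "x \<in> ?R" using wa by blast
    qed
    show "?R \<subseteq> ?L"
    proof
      fix x assume "x \<in> ?R"
      then obtain w a where wa: "w \<in> lists B" "a \<in> B" and x: "x = [list_encode (map \<iota> w), \<iota> a,
          list_encode (map \<iota> (case lookup cs (a # stack_run rs w) of None \<Rightarrow> [a] | Some (p, v) \<Rightarrow> v))]"
        by auto
      have "\<iota> a < card B" "map \<iota> w \<in> lists {..<card B}"
        using wa img lists_image[of \<iota> B] by blast+
      then show "x \<in> ?L" unfolding x val[OF wa, symmetric] by blast
    qed
  qed
  moreover have "recursive_relation 3 ?L"
    by (rule recursive_stack_lookup) (rule halt')
  ultimately show ?thesis using \<iota> unfolding recursive_triples_def by auto
qed

section \<open>Stackings from normal forms avoiding finitely many factors\<close>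

definition avoiding :: "'a set \<Rightarrow> 'a list set \<Rightarrow> 'a list set" where
  "avoiding B U = {w \<in> lists B. \<forall>u\<in>U. \<not> sublist u w}"

lemma sublist_snoc: "sublist u (w @ [a]) \<longleftrightarrow> suffix u (w @ [a]) \<or> sublist u w"
proof -
  have "sublist u (w @ [a]) \<longleftrightarrow> sublist (rev u) (a # rev w)"
    using sublist_rev[of u "w @ [a]"] by simp
  then show ?thesis by (simp add: sublist_Cons_right suffix_to_prefix)
qed

lemma suffix_snoc_iff: "suffix q (w @ [a]) \<longleftrightarrow> q = [] \<or> (\<exists>q'. q = q' @ [a] \<and> suffix q' w)"
  by (cases q rule: rev_cases) auto

text \<open>\<open>regular_language\<close> asks for states that are natural numbers; an injection
  of the finite state set into them allows states of any type, such as sets of words.\<close>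

lemma regular_languageI:
  fixes \<delta> :: "'q \<Rightarrow> 'a \<Rightarrow> 'q"
  assumes fin: "finite Q" and q0: "q0 \<in> Q" and \<delta>: "\<And>q a. q \<in> Q \<Longrightarrow> a \<in> A \<Longrightarrow> \<delta> q a \<in> Q"
    and L: "L = {w \<in> lists A. P (foldl \<delta> q0 w)}"
  shows "regular_language A L"
proof -
  obtain f :: "'q \<Rightarrow> nat" where f: "inj_on f Q"
    using finite_imp_inj_to_nat_seg[OF fin] by blast
  define \<delta>' where "\<delta>' = (\<lambda>n a. f (\<delta> (the_inv_into Q f n) a))"
  have run: "foldl \<delta>' (f q) w = f (foldl \<delta> q w) \<and> foldl \<delta> q w \<in> Q" if "q \<in> Q" "w \<in> lists A" for q w
    using that by (induction w arbitrary: q) (auto simp: \<delta>'_def the_inv_into_f_f[OF f] \<delta>)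
  show ?thesis
    unfolding regular_language_def
  proof (intro exI conjI)
    show "finite (f ` Q)" "f q0 \<in> f ` Q" "f ` {q \<in> Q. P q} \<subseteq> f ` Q"
      using fin q0 by auto
    show "\<forall>q\<in>f ` Q. \<forall>a\<in>A. \<delta>' q a \<in> f ` Q"
      by (auto simp: \<delta>'_def the_inv_into_f_f[OF f] \<delta>)
    show "L = {w \<in> lists A. foldl \<delta>' (f q0) w \<in> f ` {q \<in> Q. P q}}"
    proof -
      have "P (foldl \<delta> q0 w) \<longleftrightarrow> foldl \<delta>' (f q0) w \<in> f ` {q \<in> Q. P q}" if "w \<in> lists A" for w
        using run[OF q0 that] f by (auto dest: inj_onD)
      then show ?thesis unfolding L by blast
    qed
  qed
qed

text \<open>After reading \<open>w\<close>, the automaton stores the prefixes of words in \<open>U\<close> that are suffixes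
  of \<open>w\<close>, together with the words of \<open>U\<close> that have already occurred.\<close>

lemma regular_avoiding:
  assumes fin: "finite U"
  shows "regular_language A (avoiding A U)"
proof -
  define V where "V = (\<Union>u\<in>U. set (prefixes u))"
  have V: "p \<in> V \<longleftrightarrow> (\<exists>u\<in>U. prefix p u)" for p by (auto simp: V_def)
  define \<delta> :: "'a list set \<times> 'a list set \<Rightarrow> 'a \<Rightarrow> 'a list set \<times> 'a list set" where
    "\<delta> = (\<lambda>(q, r) a. let q' = {p \<in> V. p = [] \<or> (\<exists>p'\<in>q. p = p' @ [a])} in (q', (r \<union> q') \<inter> U))"
  define q0 :: "'a list set \<times> 'a list set" where "q0 = ({[]} \<inter> V, {[]} \<inter> U)"
  have run: "foldl \<delta> q0 w = ({p \<in> V. suffix p w}, {u \<in> U. sublist u w})" for w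
  proof (induction w rule: rev_induct)
    case Nil
    show ?case by (auto simp: q0_def)
  next
    case (snoc a w)
    \<comment> \<open>Since \<open>V\<close> is closed under prefixes, a suffix
      \<open>p' @ [a]\<close> of \<open>w @ [a]\<close> in \<open>V\<close> comes from a suffix
      \<open>p'\<close> of \<open>w\<close> in \<open>V\<close>.\<close>
    have q: "{p \<in> V. p = [] \<or> (\<exists>p'\<in>{p \<in> V. suffix p w}. p = p' @ [a])} = {p \<in> V. suffix p (w @ [a])}"
      unfolding suffix_snoc_iff V by (auto dest: append_prefixD)
    have "U \<subseteq> V" by (auto simp: V)
    then have "({u \<in> U. sublist u w} \<union> {p \<in> V. suffix p (w @ [a])}) \<inter> U = {u \<in> U. sublist u (w @ [a])}"
      unfolding sublist_snoc by blast
    then show ?case unfolding foldl_append snoc by (simp add: \<delta>_def Let_def q[simplified])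
  qed
  show ?thesis
  proof (rule regular_languageI)
    have "finite V" using fin by (simp add: V_def)
    then show "finite (Pow V \<times> Pow U)" using fin by simp
    show "q0 \<in> Pow V \<times> Pow U" by (auto simp: q0_def)
    show "\<delta> q a \<in> Pow V \<times> Pow U" for q a by (auto simp: \<delta>_def Let_def split: prod.split)
    show "avoiding A U = {w \<in> lists A. snd (foldl \<delta> q0 w) = {}}"
      unfolding run by (auto simp: avoiding_def)
  qed
qed

lemma lookup_append:
  "lookup (r1 @ r2) t = (case lookup r1 t of None \<Rightarrow> lookup r2 t | Some x \<Rightarrow> Some x)"
  by (induction r1) auto

text \<open>By well-founded induction: whatever lies below \<open>y\<close> is one of its finitely
  many direct predecessors or lies below one of them.\<close>

lemma finite_trancl_below:
  assumes wf: "wf r" and fin: "\<And>y. finite {x. (x, y) \<in> r}"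
  shows "finite {x. (x, y) \<in> r\<^sup>+}"
  using wf
proof (induction y rule: wf_induct_rule)
  case (less y)
  have "{x. (x, y) \<in> r\<^sup>+} \<subseteq> {x. (x, y) \<in> r} \<union> (\<Union>z\<in>{z. (z, y) \<in> r}. {x. (x, z) \<in> r\<^sup>+})"
    by (auto elim: tranclE)
  moreover have "finite \<dots>" using fin less by auto
  ultimately show ?case by (rule finite_subset)
qed

section \<open>Values of words and paths in the Cayley graph\<close>

context group
begin

lemma word_val_closed: "w \<in> lists (carrier G) \<Longrightarrow> word_val G w \<in> carrier G"
  by (induction w) (auto simp: word_val_def)

lemma word_val_simps [simp]:
  "word_val G [] = \<one>" "word_val G (a # w) = a \<otimes> word_val G w"
  by (simp_all add: word_val_def)

lemma word_val_append:
  "v \<in> lists (carrier G) \<Longrightarrow> w \<in> lists (carrier G) \<Longrightarrow>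
    word_val G (v @ w) = word_val G v \<otimes> word_val G w"
  by (induction v) (auto simp: word_val_closed m_assoc)

lemma word_val_rev_inv:
  "w \<in> lists (carrier G) \<Longrightarrow> word_val G (rev (map (m_inv G) w)) = inv (word_val G w)"
proof (induction w)
  case (Cons a w)
  have "rev (map (m_inv G) w) \<in> lists (carrier G)" using Cons by auto
  then show ?case using Cons by (simp add: word_val_append word_val_closed inv_mult_group)
qed simp

end

lemma path_edges_append:
  assumes "group G" "v \<in> lists (carrier G)" "w \<in> lists (carrier G)" "g \<in> carrier G"
  shows "path_edges G g (v @ w) = path_edges G g v @ path_edges G (g \<otimes>\<^bsub>G\<^esub> word_val G v) w"
proof -
  interpret group G by fact
  show ?thesis using assms(2-4)
    by (induction v arbitrary: g) (auto simp: word_val_closed m_assoc)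
qed

lemma path_edgesE:
  assumes "group G" "w \<in> lists (carrier G)" "g \<in> carrier G" "(h, b) \<in> set (path_edges G g w)"
  obtains w1 w2 where "w = w1 @ b # w2" "h = g \<otimes>\<^bsub>G\<^esub> word_val G w1"
proof -
  interpret group G by fact
  have "\<exists>w1 w2. w = w1 @ b # w2 \<and> h = g \<otimes>\<^bsub>G\<^esub> word_val G w1"
    using assms(2-4)
  proof (induction w arbitrary: g rule: list.induct)
    case (Cons a w)
    show ?case
    proof (cases "(h, b) = (g, a)")
      case True
      then show ?thesis using Cons.prems by (intro exI[of _ "[]"] exI[of _ w]) auto
    next
      case False
      moreover have "a \<in> carrier G" using Cons.prems(1) by simp
      with Cons.prems(2) have "g \<otimes>\<^bsub>G\<^esub> a \<in> carrier G" by (rule m_closed)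
      ultimately obtain w1 w2 where "w = w1 @ b # w2" "h = (g \<otimes>\<^bsub>G\<^esub> a) \<otimes>\<^bsub>G\<^esub> word_val G w1"
        using Cons.IH[of "g \<otimes>\<^bsub>G\<^esub> a"] Cons.prems by auto
      then show ?thesis using Cons.prems
        by (intro exI[of _ "a # w1"] exI[of _ w2]) (auto simp: m_assoc word_val_closed)
    qed
  qed simp
  then show ?thesis using that by blast
qed

section \<open>Reduction of words to normal forms\<close>

text \<open>All that the stacking takes from the rewriting system: normal forms given by finitely
  many forbidden factors, and termination of replacing such a factor by its normal form.
  \<open>L\<close> is a list, so that a first matching factor can be looked up.\<close>

locale avoiding_normal_forms = group G for G (structure) +
  fixes B :: "'a set" and L :: "'a list list"
  assumes finite_B: "finite B"
    and sgs: "symmetric_generating_set G B"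
    and L_lists: "set L \<subseteq> lists B"
    and normal: "normal_forms G B (avoiding B (set L))"
    and wf_reduction: "wf {(x @ nf G (avoiding B (set L)) (word_val G u) @ z, x @ u @ z) | x u z.
      x \<in> lists B \<and> z \<in> lists B \<and> u \<in> set L}"
begin

definition N :: "'a list set" where "N = avoiding B (set L)"

abbreviation val :: "'a list \<Rightarrow> 'a" where "val \<equiv> word_val G"

abbreviation y :: "'a \<Rightarrow> 'a list" where "y \<equiv> nf G N"

text \<open>Pairs are written (reduct, word), so that \<open>wf\<close> expresses
  termination.\<close>

definition red :: "('a list \<times> 'a list) set" where
  "red = {(x @ y (val u) @ z, x @ u @ z) | x u z. x \<in> lists B \<and> z \<in> lists B \<and> u \<in> set L}"

lemma wf_red: "wf red"
  using wf_reduction unfolding red_def N_def .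

lemma B_carrier: "B \<subseteq> carrier G" and inv_B: "a \<in> B \<Longrightarrow> inv a \<in> B"
  using sgs by (auto simp: symmetric_generating_set_def)

lemma lists_carrier: "w \<in> lists B \<Longrightarrow> w \<in> lists (carrier G)"
  using B_carrier lists_mono by blast

lemma val_closed: "w \<in> lists B \<Longrightarrow> val w \<in> carrier G"
  by (simp add: lists_carrier word_val_closed del: in_lists_conv_set)

lemma val_append: "v \<in> lists B \<Longrightarrow> w \<in> lists B \<Longrightarrow> val (v @ w) = val v \<otimes> val w"
  by (simp add: lists_carrier word_val_append del: in_lists_conv_set)

lemma N_lists: "w \<in> N \<Longrightarrow> w \<in> lists B"
  by (simp add: N_def avoiding_def)

lemma N_sublist:
  assumes "w \<in> N" "sublist v w" shows "v \<in> N"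
proof -
  have "v \<in> lists B" using N_lists[OF assms(1)] set_mono_sublist[OF assms(2)] by auto
  moreover have "\<not> sublist u v" if "u \<in> set L" for u
    using assms sublist_order.order.trans[of u v w] that by (auto simp: N_def avoiding_def)
  ultimately show ?thesis by (simp add: N_def avoiding_def)
qed

lemma ex1_N: "g \<in> carrier G \<Longrightarrow> \<exists>!w. w \<in> N \<and> val w = g"
  using normal by (simp add: normal_forms_def N_def)

lemma y_N: "g \<in> carrier G \<Longrightarrow> y g \<in> N" and val_y: "g \<in> carrier G \<Longrightarrow> val (y g) = g"
  using theI'[OF ex1_N] by (simp_all add: nf_def)

lemma y_val: "w \<in> N \<Longrightarrow> y (val w) = w"
  using ex1_N[OF val_closed[OF N_lists]] y_N val_y val_closed[OF N_lists] by metis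

lemma y_lists: "g \<in> carrier G \<Longrightarrow> y g \<in> lists B"
  by (rule N_lists[OF y_N])

text \<open>Some word avoids all of \<open>L\<close>, and the empty word is a factor of every
  word.\<close>

lemma Nil_notin_L: "[] \<notin> set L"
  using y_N[OF one_closed] by (auto simp: N_def avoiding_def)

lemma Nil_N: "[] \<in> N"
  using Nil_notin_L by (auto simp: N_def avoiding_def)

lemma red_context:
  assumes "(v, w) \<in> red" "p \<in> lists B" "q \<in> lists B"
  shows "(p @ v @ q, p @ w @ q) \<in> red"
proof -
  obtain x u z where "v = x @ y (val u) @ z" "w = x @ u @ z"
    and xzu: "x \<in> lists B" "z \<in> lists B" "u \<in> set L"
    using assms(1) unfolding red_def by blast
  then have "p @ v @ q = (p @ x) @ y (val u) @ (z @ q)" "p @ w @ q = (p @ x) @ u @ (z @ q)" by auto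
  moreover have "p @ x \<in> lists B" "z @ q \<in> lists B" using assms xzu by auto
  ultimately show ?thesis using xzu(3) unfolding red_def by blast
qed

lemma red_rtrancl_context:
  assumes "(v, w) \<in> red\<^sup>*" "p \<in> lists B" "q \<in> lists B"
  shows "(p @ v @ q, p @ w @ q) \<in> red\<^sup>*"
  using assms(1)
  by (induction rule: rtrancl_induct) (use red_context[OF _ assms(2,3)] in \<open>auto intro: rtrancl_into_rtrancl\<close>)

lemma red_trancl_context:
  assumes "(v, w) \<in> red\<^sup>+" "p \<in> lists B" "q \<in> lists B"
  shows "(p @ v @ q, p @ w @ q) \<in> red\<^sup>+"
  using assms(1)
  by (induction rule: trancl_induct) (use red_context[OF _ assms(2,3)] in \<open>auto intro: trancl_into_trancl\<close>)

text \<open>A word outside \<open>N\<close> contains some \<open>u\<close> in \<open>L\<close>, and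
  replacing it keeps the value. Termination thus leads into \<open>N\<close>, where the only word
  with this value is the normal form; uniqueness of normal forms takes the place of
  confluence.\<close>

lemma red_y_val: "w \<in> lists B \<Longrightarrow> (y (val w), w) \<in> red\<^sup>*"
proof (induction w rule: wf_induct_rule[OF wf_red])
  case (1 w)
  show ?case
  proof (cases "w \<in> N")
    case True
    then show ?thesis by (simp add: y_val)
  next
    case False
    then obtain x u z where u: "u \<in> set L" and w: "w = x @ u @ z"
      using 1(2) by (auto simp: N_def avoiding_def sublist_def)
    have lists: "x \<in> lists B" "z \<in> lists B" "u \<in> lists B" using 1(2) w by auto
    let ?w = "x @ y (val u) @ z"
    have "y (val u) \<in> lists B" using lists by (intro y_lists val_closed)
    then have "?w \<in> lists B" "val ?w = val w"
      using lists by (simp_all add: w val_append val_closed val_y del: in_lists_conv_set)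
    moreover have "(?w, w) \<in> red" using u w lists unfolding red_def by blast
    ultimately show ?thesis using 1(1)[of ?w] by (metis rtrancl.rtrancl_into_rtrancl)
  qed
qed

text \<open>A prefix of a reduct counts as smaller; passing to prefixes commutes with reduction,
  which keeps the relation well-founded.\<close>

definition red_prefix :: "('a list \<times> 'a list) set" where
  "red_prefix = {(v, w). \<exists>z\<in>lists B. (v @ z, w) \<in> red\<^sup>+}"

lemma wf_red_prefix: "wf red_prefix"
proof (rule acc_wfI, rule allI)
  fix w
  \<comment> \<open>Accessibility is claimed for all prefixes \<open>p\<close> of \<open>w\<close>
    at once: if \<open>v @ z\<close> is a proper reduct of \<open>p\<close>, then
    \<open>v @ z @ q\<close> is one of \<open>w = p @ q\<close>, and \<open>v\<close> is a prefix of
    it.\<close>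
  have "\<forall>p. \<forall>q\<in>lists B. w = p @ q \<longrightarrow> p \<in> Wellfounded.acc red_prefix" for w
  proof (induction w rule: wf_induct_rule[OF wf_trancl[OF wf_red]])
    case (1 w)
    show ?case
    proof (intro allI ballI impI)
      fix p q assume q: "q \<in> lists B" and w: "w = p @ q"
      show "p \<in> Wellfounded.acc red_prefix"
      proof (rule accI)
        fix v assume "(v, p) \<in> red_prefix"
        then obtain z where z: "z \<in> lists B" "(v @ z, p) \<in> red\<^sup>+" by (auto simp: red_prefix_def)
        from red_trancl_context[OF z(2) _ q, of "[]"] have "(v @ (z @ q), w) \<in> red\<^sup>+"
          by (simp add: w)
        from 1[OF this] show "v \<in> Wellfounded.acc red_prefix" using z(1) q by auto
      qed
    qed
  qed
  from this[of w] show "w \<in> Wellfounded.acc red_prefix" by auto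
qed

section \<open>The stacking and the well-foundedness of its order\<close>

definition path_word :: "'a list \<Rightarrow> 'a list" where
  "path_word u = rev (map (m_inv G) (butlast u)) @ y (val u)"

text \<open>The list looked up is \<open>y g @ [a]\<close> reversed, so forbidden suffixes become
  prefixes. Of several, the first in \<open>L\<close> is taken, which makes the choice a finite
  lookup. On an edge of the graph, the default occurs only if \<open>y g @ [a]\<close> is a normal
  form.\<close>

definition c :: "'a \<times> 'a \<Rightarrow> 'a list" where
  "c = (\<lambda>(g, a). case lookup (map (\<lambda>u. (rev u, path_word u)) L) (a # rev (y g)) of
     None \<Rightarrow> [a] | Some (p, v) \<Rightarrow> v)"

text \<open>A word of \<open>N\<close> is the normal form of its value, and \<open>N\<close> is
  closed under prefixes. Hence both alternatives can be read off from \<open>y g\<close> and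
  \<open>a\<close> without the normal form of the target vertex, which is what a lookup on the stack
  can test.\<close>

lemma degenerate_iff:
  assumes g: "g \<in> carrier G" and a: "a \<in> B"
  shows "(g, a) \<in> degenerate_edges G B N \<longleftrightarrow> y g @ [a] \<in> N \<or> (\<exists>w. y g = w @ [inv a])"
proof -
  have aG: "a \<in> carrier G" using a B_carrier by blast
  have 1: "y g @ [a] = y (g \<otimes> a) \<longleftrightarrow> y g @ [a] \<in> N"
  proof
    assume "y g @ [a] \<in> N"
    then have "y (val (y g @ [a])) = y g @ [a]" by (rule y_val)
    moreover have "val (y g @ [a]) = g \<otimes> a"
      using g a aG y_lists[OF g] by (subst val_append) (auto simp: val_y)
    ultimately show "y g @ [a] = y (g \<otimes> a)" by simp
  qed (use g aG y_N[of "g \<otimes> a"] in auto)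
  have 2: "y g = y (g \<otimes> a) @ [inv a] \<longleftrightarrow> (\<exists>w. y g = w @ [inv a])"
  proof
    assume "\<exists>w. y g = w @ [inv a]"
    then obtain w where w: "y g = w @ [inv a]" ..
    then have "w \<in> N" using y_N[OF g] N_sublist by (metis prefixI prefix_imp_sublist)
    moreover have "val w \<otimes> inv a = g"
      using val_y[OF g] w val_append[OF N_lists[OF \<open>w \<in> N\<close>], of "[inv a]"] inv_B[OF a] aG by simp
    then have "val w = g \<otimes> a"
      using val_closed[OF N_lists[OF \<open>w \<in> N\<close>]] aG by (auto simp: m_assoc)
    ultimately show "y g = y (g \<otimes> a) @ [inv a]" using w y_val by metis
  qed auto
  show ?thesis
    using g a unfolding 1[symmetric] 2[symmetric] by (auto simp: degenerate_edges_def cayley_edges_def)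
qed

lemma recursive_edgesD:
  assumes "(g, a) \<in> recursive_edges G B N"
  shows "g \<in> carrier G" "a \<in> B" "y g @ [a] \<notin> N" "y g \<noteq> w @ [inv a]"
  using assms degenerate_iff by (auto simp: recursive_edges_def cayley_edges_def)

text \<open>As \<open>w\<close> contains no forbidden factor, a forbidden factor of
  \<open>w @ [a]\<close> has to be a suffix. \<open>f\<close> is arbitrary because the tables for
  \<open>c\<close> and for the reduction machine have the same keys.\<close>

lemma snoc_N_iff:
  assumes "w \<in> N" "a \<in> B"
  shows "w @ [a] \<in> N \<longleftrightarrow> lookup (map (\<lambda>u. (rev u, f u)) L) (a # rev w) = None"
proof -
  have "w @ [a] \<in> N \<longleftrightarrow> (\<forall>u\<in>set L. \<not> suffix u (w @ [a]))"
    using assms by (auto simp: N_def avoiding_def sublist_snoc)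
  then show ?thesis by (simp add: lookup_eq_None suffix_to_prefix)
qed

lemma lookup_suffixE:
  assumes "w \<in> N" "lookup (map (\<lambda>u. (rev u, f u)) L) (a # rev w) = Some (p, v)"
  obtains u x where "u @ [a] \<in> set L" "w = x @ u" "p = a # rev u" "v = f (u @ [a])" "u \<in> N"
proof -
  have "(p, v) \<in> set (map (\<lambda>u. (rev u, f u)) L)" "prefix p (a # rev w)"
    using lookup_SomeD[OF assms(2)] by auto
  then obtain u where u: "u \<in> set L" "p = rev u" "v = f u" by auto
  with Nil_notin_L obtain u' b where ub: "u = u' @ [b]" by (cases u rule: rev_cases) auto
  have "prefix (rev u) (rev (w @ [a]))" using \<open>prefix p _\<close> u by simp
  then have "suffix u (w @ [a])" by (simp add: suffix_to_prefix)
  then have "b = a" "suffix u' w" unfolding ub by auto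
  moreover from this obtain x where "w = x @ u'" by (auto simp: suffix_def)
  moreover have "u' \<in> N" using N_sublist[OF assms(1)] \<open>suffix u' w\<close> by auto
  ultimately show ?thesis using that u ub by auto
qed

lemma c_recursiveE:
  assumes "(g, a) \<in> recursive_edges G B N"
  obtains u x where "u @ [a] \<in> set L" "y g = x @ u" "c (g, a) = path_word (u @ [a])"
proof -
  note D = recursive_edgesD[OF assms]
  let ?l = "lookup (map (\<lambda>u. (rev u, path_word u)) L) (a # rev (y g))"
  have "?l \<noteq> None" using snoc_N_iff[OF y_N[OF D(1)] D(2)] D(3) by blast
  then obtain p v where *: "?l = Some (p, v)" by auto
  show ?thesis
    by (rule lookup_suffixE[OF y_N[OF D(1)] *]) (rule that, use * in \<open>auto simp: c_def\<close>)
qed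

lemma rev_inv_lists: "w \<in> lists B \<Longrightarrow> rev (map (m_inv G) w) \<in> lists B"
  using inv_B by auto

lemma path_word_lists: "u \<in> set L \<Longrightarrow> path_word u \<in> lists B"
proof -
  assume "u \<in> set L"
  then have "u \<in> lists B" using L_lists by blast
  moreover from this have "butlast u \<in> lists B" by (auto dest: in_set_butlastD)
  ultimately show ?thesis unfolding path_word_def
    using rev_inv_lists y_lists val_closed by (metis append_in_lists_conv)
qed

text \<open>Condition (S1), by \<open>inv (val u) \<otimes> (val u \<otimes> a) = a\<close>.\<close>

lemma val_path_word:
  assumes "u @ [a] \<in> set L" shows "val (path_word (u @ [a])) = a"
proof -
  have ua: "u \<in> lists B" "a \<in> B" using assms L_lists by auto
  have "val (rev (map (m_inv G) u)) = inv (val u)" "val (u @ [a]) = val u \<otimes> a"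
    using word_val_rev_inv[OF lists_carrier[OF ua(1)]] val_append[OF ua(1), of "[a]"] ua(2) B_carrier by auto
  moreover have "u @ [a] \<in> lists B" using ua by simp
  ultimately have "val (path_word (u @ [a])) = inv (val u) \<otimes> (val u \<otimes> a)"
    using val_append[OF rev_inv_lists[OF ua(1)] y_lists[OF val_closed[of "u @ [a]"]]]
      val_y[OF val_closed[of "u @ [a]"]] by (simp add: path_word_def del: in_lists_conv_set)
  also have "\<dots> = a" using ua val_closed[of u] B_carrier by (auto simp: m_assoc[symmetric])
  finally show ?thesis .
qed

text \<open>Walking back from \<open>x @ u @ [b]\<close> uses the label \<open>inv b\<close>, and
  the normal form at that vertex ends in \<open>b = inv (inv b)\<close>; this is the second kind of
  degenerate edge. The walk stays among prefixes of a normal form, which are normal forms.\<close>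

lemma backward_path_degenerate:
  assumes "x @ u \<in> N" "e \<in> set (path_edges G (val (x @ u)) (rev (map (m_inv G) u)))"
  shows "e \<in> degenerate_edges G B N"
  using assms
proof (induction u rule: rev_induct)
  case (snoc b u)
  have l: "x \<in> lists B" "u \<in> lists B" "b \<in> B" using N_lists[OF snoc.prems(1)] by auto
  then have bG: "b \<in> carrier G" using B_carrier by blast
  have "x @ u \<in> N" using snoc.prems(1) N_sublist[of "x @ u @ [b]" "x @ u"] by (auto intro: prefix_imp_sublist)
  have v: "val (x @ u @ [b]) \<otimes> inv b = val (x @ u)"
    using l bG val_append[of "x @ u" "[b]"] val_closed[of "x @ u"] by (simp add: m_assoc)
  show ?case
  proof (cases "e = (val (x @ u @ [b]), inv b)")
    case True
    have "y (val (x @ u @ [b])) = (x @ u) @ [inv (inv b)]"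
      using y_val[OF snoc.prems(1)] bG by simp
    then show ?thesis unfolding True
      using val_closed[OF N_lists[OF snoc.prems(1)]] inv_B[OF l(3)] by (subst degenerate_iff) auto
  next
    case False
    then have "e \<in> set (path_edges G (val (x @ u)) (rev (map (m_inv G) u)))"
      using snoc.prems(2) v by auto
    with snoc.IH \<open>x @ u \<in> N\<close> show ?thesis by blast
  qed
qed simp

definition dependency :: "(('a \<times> 'a) \<times> ('a \<times> 'a)) set" where
  "dependency = {(e', e). e' \<in> recursive_edges G B N \<and> e \<in> recursive_edges G B N \<and>
     e' \<in> set (path_edges G (fst e) (c e))}"

text \<open>With \<open>y g = x @ u\<close> and \<open>u @ [a]\<close> forbidden,
  \<open>y g @ [a]\<close> reduces in one step to \<open>x @ z1 @ b # z2\<close>, where the edge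
  starts after \<open>x @ z1\<close>. Reducing \<open>x @ z1\<close> further to \<open>y h\<close>
  gives \<open>y h @ b # z2\<close>, which has \<open>y h @ [b]\<close> as a prefix.\<close>

lemma dependency_red_prefix:
  assumes "((h, b), (g, a)) \<in> dependency"
  shows "(y h @ [b], y g @ [a]) \<in> red_prefix"
proof -
  have hb: "(h, b) \<in> recursive_edges G B N" and ga: "(g, a) \<in> recursive_edges G B N"
    and path: "(h, b) \<in> set (path_edges G g (c (g, a)))"
    using assms by (auto simp: dependency_def)
  obtain u x where u: "u @ [a] \<in> set L" and yg: "y g = x @ u" and c: "c (g, a) = path_word (u @ [a])"
    by (rule c_recursiveE[OF ga])
  note D = recursive_edgesD(1,2)[OF ga]
  have xu: "x @ u \<in> N" using y_N[OF D(1)] yg by simp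
  have g: "g = val (x @ u)" using val_y[OF D(1)] yg by simp
  have l: "x \<in> lists B" "u \<in> lists B" using N_lists[OF xu] by auto
  have uL: "u @ [a] \<in> lists B" using u L_lists by blast
  let ?z = "y (val (u @ [a]))"
  have z: "?z \<in> lists B" using y_lists val_closed uL by blast
  \<comment> \<open>After its backward part the path has reached the vertex of \<open>x\<close>,
    from where it follows the normal form of \<open>u @ [a]\<close>.\<close>
  have "val (x @ u) \<otimes> val (rev (map (m_inv G) u)) = val x"
    using l by (simp add: val_append word_val_rev_inv lists_carrier val_closed m_assoc del: in_lists_conv_set)
  then have "path_edges G g (c (g, a)) =
      path_edges G (val (x @ u)) (rev (map (m_inv G) u)) @ path_edges G (val x) ?z"
    using path_edges_append[OF is_group lists_carrier[OF rev_inv_lists[OF l(2)]] lists_carrier[OF z] D(1)]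
    by (simp add: c[unfolded g] path_word_def g)
  moreover have "(h, b) \<notin> set (path_edges G (val (x @ u)) (rev (map (m_inv G) u)))"
    using backward_path_degenerate[OF xu] hb by (auto simp: recursive_edges_def)
  ultimately have "(h, b) \<in> set (path_edges G (val x) ?z)" using path by simp
  then obtain z1 z2 where zz: "?z = z1 @ b # z2" and h: "h = val x \<otimes> val z1"
    using path_edgesE[OF is_group lists_carrier[OF z] val_closed[OF l(1)]] by blast
  have zl: "z1 \<in> lists B" "b \<in> B" "z2 \<in> lists B" using z unfolding zz by auto
  have "(y h, x @ z1) \<in> red\<^sup>*"
    using red_y_val[of "x @ z1"] l zl h by (simp add: val_append)
  from red_rtrancl_context[OF this, of "[]" "b # z2"] have "(y h @ b # z2, x @ ?z) \<in> red\<^sup>*"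
    using zl zz by simp
  moreover have "(x @ ?z @ [], x @ (u @ [a]) @ []) \<in> red"
    unfolding red_def using l(1) u by blast
  ultimately have "((y h @ [b]) @ z2, y g @ [a]) \<in> red\<^sup>+"
    by (simp add: yg)
  then show ?thesis using zl(3) unfolding red_prefix_def by blast
qed

lemma wf_dependency: "wf dependency"
proof (rule wf_subset)
  show "wf (inv_image red_prefix (\<lambda>(g, a). y g @ [a]))"
    by (rule wf_inv_image[OF wf_red_prefix])
  show "dependency \<subseteq> inv_image red_prefix (\<lambda>(g, a). y g @ [a])"
    using dependency_red_prefix by (auto simp: inv_image_def)
qed

text \<open>(S2) follows from well-foundedness together with the finiteness of each path, and (S3)
  because \<open>c\<close> takes only values \<open>path_word u\<close> with \<open>u\<close> in
  \<open>L\<close> on recursive edges.\<close>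

lemma stacking_c: "stacking G B N c"
proof -
  have order: "stacking_order G B N c = dependency\<^sup>+"
    unfolding stacking_order_def dependency_def ..
  have "finite {e'. (e', e) \<in> dependency}" for e
    by (rule finite_subset[of _ "set (path_edges G (fst e) (c e))"]) (auto simp: dependency_def)
  then have fin: "finite {e'. (e', e) \<in> dependency\<^sup>+}" for e
    by (rule finite_trancl_below[OF wf_dependency])
  have "finite {e' \<in> recursive_edges G B N. (e', e) \<in> dependency\<^sup>+}" for e
    by (rule finite_subset[OF _ fin[of e]]) auto
  moreover have "irrefl (dependency\<^sup>+)"
    using wf_irrefl[OF wf_trancl[OF wf_dependency]] by (auto simp: irrefl_def)
  moreover
  have c: "c e \<in> path_word ` set L" if "e \<in> recursive_edges G B N" for e
  proof -
    obtain g a where e: "e = (g, a)" by force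
    show ?thesis by (rule c_recursiveE[OF that[unfolded e]]) (simp add: e)
  qed
  have "c ` recursive_edges G B N \<subseteq> path_word ` set L"
    by (rule image_subsetI) (rule c)
  then have "finite (c ` recursive_edges G B N)" by (rule finite_subset) simp
  moreover have "c \<in> recursive_edges G B N \<rightarrow> lists B"
  proof (rule Pi_I)
    fix e assume "e \<in> recursive_edges G B N"
    from c[OF this] obtain u where "u \<in> set L" "c e = path_word u" by auto
    then show "c e \<in> lists B" using path_word_lists by simp
  qed
  moreover have "\<forall>(g, a)\<in>recursive_edges G B N. val (c (g, a)) = a"
  proof safe
    fix g a assume "(g, a) \<in> recursive_edges G B N"
    then show "val (c (g, a)) = a" by (rule c_recursiveE) (simp add: val_path_word)
  qed
  moreover have "y \<one> = []" using y_val[OF Nil_N] by simp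
  ultimately show ?thesis
    unfolding stacking_def order using normal[folded N_def] trans_trancl by (intro conjI ballI) simp_all
qed

section \<open>Computing normal forms and the stacking by machine\<close>

definition red_rules :: "('a list \<times> 'a list) list" where
  "red_rules = map (\<lambda>u. (rev u, y (val u))) L"

text \<open>The invariant: the reversed stack is a normal form, and the whole word keeps its value.
  A match replaces a forbidden factor of the whole word; otherwise a letter moves to the stack and
  the word stays the same. The second claim thus provides a lexicographic termination
  measure.\<close>

lemma stack_step_red_rules:
  assumes "s \<in> lists B" "i \<in> lists B" "rev s \<in> N" "val (rev s @ i) = g" "stack_step red_rules (s, i) = (s', i')"
  shows "s' \<in> lists B \<and> i' \<in> lists B \<and> rev s' \<in> N \<and> val (rev s' @ i') = g"
    and "i \<noteq> [] \<Longrightarrow> (rev s' @ i', rev s @ i) \<in> red \<or> rev s' @ i' = rev s @ i \<and> length i' < length i"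
proof -
  have "(s' \<in> lists B \<and> i' \<in> lists B \<and> rev s' \<in> N \<and> val (rev s' @ i') = g) \<and>
    (i \<noteq> [] \<longrightarrow> (rev s' @ i', rev s @ i) \<in> red \<or> rev s' @ i' = rev s @ i \<and> length i' < length i)"
  proof (cases i)
    case Nil
    then show ?thesis using assms by (auto simp: stack_step_def)
  next
    case (Cons a j)
    have aj: "a \<in> B" "j \<in> lists B" using assms(2) Cons by auto
    show ?thesis
    proof (cases "lookup red_rules (a # s)")
      case None
      then have "s' = a # s" "i' = j" using assms(5) Cons by (auto simp: stack_step_def)
      moreover have "rev s @ [a] \<in> N"
        using snoc_N_iff[OF assms(3) aj(1), of "\<lambda>u. y (val u)"] None by (simp add: red_rules_def)
      ultimately show ?thesis using assms(1,4) aj Cons by auto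
    next
      case (Some r)
      then obtain p v where r: "lookup red_rules (a # rev (rev s)) = Some (p, v)" by (cases r) auto
      from r[unfolded red_rules_def] obtain u x where u: "u @ [a] \<in> set L" "rev s = x @ u"
        "p = a # rev u" "v = y (val (u @ [a]))" "u \<in> N"
        by (rule lookup_suffixE[OF assms(3)])
      have s: "s = rev u @ rev x" using u(2) by (metis rev_append rev_rev_ident)
      have s': "s' = rev x" and i': "i' = v @ j"
        using assms(5) Cons r u(3) by (auto simp: stack_step_def s)
      have l: "x \<in> lists B" "u \<in> lists B" using assms(1) s by auto
      have v: "v \<in> lists B" unfolding u(4) using l aj by (intro y_lists val_closed) auto
      have "x \<in> N" using assms(3) N_sublist u(2) by (metis prefixI prefix_imp_sublist)
      moreover have "val (x @ v @ j) = val (x @ (u @ [a]) @ j)"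
        using l aj v u(4) val_closed[of "u @ [a]"] by (simp only: val_append val_y append_in_lists_conv lists.Cons lists.Nil)
      moreover have "(x @ v @ j, x @ (u @ [a]) @ j) \<in> red"
        unfolding u(4) red_def using u(1) l(1) aj(2) by blast
      ultimately show ?thesis using l v aj assms(4) by (auto simp: s' i' s Cons)
    qed
  qed
  then show "s' \<in> lists B \<and> i' \<in> lists B \<and> rev s' \<in> N \<and> val (rev s' @ i') = g"
    "i \<noteq> [] \<Longrightarrow> (rev s' @ i', rev s @ i) \<in> red \<or> rev s' @ i' = rev s @ i \<and> length i' < length i"
    by auto
qed

lemma stack_halts:
  assumes "s \<in> lists B" "i \<in> lists B" "rev s \<in> N" "val (rev s @ i) = g"
  shows "\<exists>m. snd ((stack_step red_rules ^^ m) (s, i)) = []"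
proof -
  let ?R = "inv_image (red <*lex*> less_than) (\<lambda>(s, i). (rev s @ i, length i))"
  have "wf ?R" by (intro wf_inv_image wf_lex_prod wf_red wf_less_than)
  then show ?thesis
    using assms
  proof (induction "(s, i)" arbitrary: s i rule: wf_induct_rule)
    case less
    obtain s' i' where st: "stack_step red_rules (s, i) = (s', i')" by force
    note st' = stack_step_red_rules[OF less.prems st]
    show ?case
    proof (cases "i = []")
      case True
      then show ?thesis by (intro exI[of _ 0]) simp
    next
      case False
      from st'(2)[OF this] have "((s', i'), (s, i)) \<in> ?R" by auto
      from less.hyps[OF this] st'(1) obtain m where "snd ((stack_step red_rules ^^ m) (s', i')) = []" by blast
      then show ?thesis
        by (intro exI[of _ "Suc m"]) (simp add: funpow_Suc_right st del: funpow.simps)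
    qed
  qed
qed

lemma stack_steps_red_rules:
  assumes "w \<in> lists B" "(stack_step red_rules ^^ m) ([], w) = (s, i)"
  shows "s \<in> lists B \<and> i \<in> lists B \<and> rev s \<in> N \<and> val (rev s @ i) = val w"
  using assms(2)
proof (induction m arbitrary: s i)
  case 0
  then show ?case using assms(1) Nil_N by auto
next
  case (Suc m)
  obtain s1 i1 where 1: "(stack_step red_rules ^^ m) ([], w) = (s1, i1)" by force
  have "stack_step red_rules (s1, i1) = (s, i)" using Suc.prems 1 by simp
  with stack_step_red_rules(1) Suc.IH[OF 1] show ?case by blast
qed

text \<open>On halting the input is empty, so the reversed stack is a word of \<open>N\<close> with
  the value of \<open>w\<close>.\<close>

lemma stack_run_red_rules:
  assumes "w \<in> lists B"
  shows "stack_run red_rules w = rev (y (val w))"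
proof -
  let ?m = "LEAST m. snd ((stack_step red_rules ^^ m) ([], w)) = []"
  have "\<exists>m. snd ((stack_step red_rules ^^ m) ([], w)) = []"
    using stack_halts[of "[]" w] assms Nil_N by auto
  then have "snd ((stack_step red_rules ^^ ?m) ([], w)) = []" by (rule LeastI_ex)
  then obtain s where s: "(stack_step red_rules ^^ ?m) ([], w) = (s, [])"
    by (metis prod.collapse)
  from stack_steps_red_rules[OF assms s] have "y (val w) = rev s" using y_val[of "rev s"] by simp
  then show ?thesis by (simp add: stack_run_def s)
qed

lemma recursive_triples_c: "recursive_triples B (stacking_triples G B N c)"
proof -
  obtain bs where bs: "set bs = B" using finite_list[OF finite_B] by blast
  \<comment> \<open>The pattern \<open>[a, inv a]\<close> matches exactly if \<open>y g\<close> ends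
    in \<open>inv a\<close>, that is, if the edge is degenerate of the second kind. These rules
    stand first, since \<open>y g @ [a]\<close> may then have a forbidden suffix as well.\<close>
  define cancel where "cancel = map (\<lambda>a. ([a, inv a], [a])) bs"
  let ?lc = "map (\<lambda>u. (rev u, path_word u)) L"
  have c': "(if (val w, a) \<in> recursive_edges G B N then c (val w, a) else [a]) =
      (case lookup (cancel @ ?lc) (a # stack_run red_rules w) of None \<Rightarrow> [a] | Some (p, v) \<Rightarrow> v)"
    if w: "w \<in> lists B" and a: "a \<in> B" for w a
  proof -
    let ?g = "val w" and ?t = "a # rev (y (val w))"
    have g: "?g \<in> carrier G" by (rule val_closed[OF w])
    have cayley: "(?g, a) \<in> recursive_edges G B N \<longleftrightarrow> (?g, a) \<notin> degenerate_edges G B N"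
      using g a by (auto simp: recursive_edges_def cayley_edges_def)
    have cancel_None: "lookup cancel ?t = None \<longleftrightarrow> (\<nexists>x. y ?g = x @ [inv a])"
    proof -
      have "(\<exists>x. y ?g = x @ [inv a]) \<longleftrightarrow> (\<exists>x. rev (y ?g) = inv a # x)"
        by (metis rev.simps(2) rev_rev_ident)
      also have "\<dots> \<longleftrightarrow> prefix [inv a] (rev (y ?g))" by (auto simp: prefix_def)
      finally show ?thesis using a by (auto simp: lookup_eq_None cancel_def bs)
    qed
    have run: "stack_run red_rules w = rev (y ?g)" by (rule stack_run_red_rules[OF w])
    show ?thesis
    proof (cases "lookup cancel ?t")
      case None
      with cancel_None have "\<nexists>x. y ?g = x @ [inv a]" by simp
      then have "(?g, a) \<in> degenerate_edges G B N \<longleftrightarrow> y ?g @ [a] \<in> N"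
        unfolding degenerate_iff[OF g a] by simp
      then have "(?g, a) \<in> recursive_edges G B N \<longleftrightarrow> lookup ?lc ?t \<noteq> None"
        unfolding cayley snoc_N_iff[OF y_N[OF g] a, of path_word] by simp
      then show ?thesis using None by (auto simp: c_def run lookup_append split: option.split)
    next
      case (Some r)
      then obtain p v where r: "lookup cancel ?t = Some (p, v)" by (cases r) auto
      have "v = [a]" using lookup_SomeD[OF r] by (auto simp: cancel_def)
      moreover have "\<exists>x. y ?g = x @ [inv a]" using r cancel_None by simp
      then have "(?g, a) \<notin> recursive_edges G B N"
        unfolding cayley degenerate_iff[OF g a] by simp
      ultimately show ?thesis using r by (simp add: run lookup_append)
    qed
  qed
  have "recursive_triples B {(w, a, case lookup (cancel @ ?lc) (a # stack_run red_rules w) of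
      None \<Rightarrow> [a] | Some (p, v) \<Rightarrow> v) | w a. w \<in> lists B \<and> a \<in> B}"
  proof (rule recursive_triples_stack_lookup[OF finite_B])
    have L: "rev u \<in> lists B \<and> y (val u) \<in> lists B \<and> path_word u \<in> lists B" if "u \<in> set L" for u
    proof -
      have "u \<in> lists B" using that L_lists by blast
      then show ?thesis using y_lists val_closed path_word_lists[OF that] by auto
    qed
    show "set red_rules \<subseteq> lists B \<times> lists B"
      using L by (auto simp: red_rules_def simp del: in_lists_conv_set)
    show "set (cancel @ ?lc) \<subseteq> lists B \<times> lists B"
      using L inv_B bs by (auto simp: cancel_def simp del: in_lists_conv_set)
    show "\<exists>m. snd ((stack_step red_rules ^^ m) ([], w)) = []" if "w \<in> lists B" for w
      using stack_halts[of "[]" w] that Nil_N by auto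
  qed
  moreover have "stacking_triples G B N c = {(w, a, case lookup (cancel @ ?lc) (a # stack_run red_rules w) of
      None \<Rightarrow> [a] | Some (p, v) \<Rightarrow> v) | w a. w \<in> lists B \<and> a \<in> B}"
    unfolding stacking_triples_def
  proof (intro Collect_cong ex_cong1)
    fix t w a
    show "t = (w, a, if (val w, a) \<in> recursive_edges G B N then c (val w, a) else [a]) \<and>
        w \<in> lists B \<and> a \<in> B \<longleftrightarrow>
      t = (w, a, case lookup (cancel @ ?lc) (a # stack_run red_rules w) of
        None \<Rightarrow> [a] | Some (p, v) \<Rightarrow> v) \<and> w \<in> lists B \<and> a \<in> B"
    proof (cases "w \<in> lists B \<and> a \<in> B")
      case True
      with c'[of w a] show ?thesis by (simp only:)
    qed (simp only: simp_thms)
  qed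
  ultimately show ?thesis by simp
qed

theorem regularly_stackable: "regularly_stackable G"
  unfolding regularly_stackable_def
  using finite_B sgs stacking_c recursive_triples_c regular_avoiding[of "set L" B]
  unfolding N_def by blast

end

section \<open>Complete rewriting systems\<close>

lemma rewriting_step_context:
  assumes "(v, w) \<in> rewriting_step A R" "p \<in> lists A" "q \<in> lists A"
  shows "(p @ v @ q, p @ w @ q) \<in> rewriting_step A R"
proof -
  obtain x u u' y where "v = x @ u @ y" "w = x @ u' @ y"
    and l: "x \<in> lists A" "y \<in> lists A" "(u, u') \<in> R"
    using assms(1) unfolding rewriting_step_def by blast
  then have "p @ v @ q = (p @ x) @ u @ (y @ q)" "p @ w @ q = (p @ x) @ u' @ (y @ q)" by auto
  moreover have "p @ x \<in> lists A" "y @ q \<in> lists A" using assms l by auto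
  ultimately show ?thesis using l(3) unfolding rewriting_step_def by blast
qed

lemma rewriting_steps_context:
  assumes "(v, w) \<in> (rewriting_step A R)\<^sup>+" "p \<in> lists A" "q \<in> lists A"
  shows "(p @ v @ q, p @ w @ q) \<in> (rewriting_step A R)\<^sup>+"
  using assms(1)
  by (induction rule: trancl_induct)
    (use rewriting_step_context[OF _ assms(2,3)] in \<open>auto intro: trancl_into_trancl\<close>)

lemma irreducible_sublist:
  assumes "irreducible_word A R w" "sublist v w"
  shows "irreducible_word A R v"
proof -
  obtain p q where w: "w = p @ v @ q" using assms(2) by (auto simp: sublist_def)
  have l: "p \<in> lists A" "v \<in> lists A" "q \<in> lists A"
    using assms(1) w by (auto simp: irreducible_word_def)
  have False if "(v, v') \<in> rewriting_step A R" for v'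
    using rewriting_step_context[OF that l(1,3)] assms(1) w by (auto simp: irreducible_word_def)
  then show ?thesis using l(2) by (auto simp: irreducible_word_def)
qed

section \<open>Words over \<open>A\<close> and the group elements they represent\<close>

locale complete_rewriting = group G for G (structure) +
  fixes A :: "'b set" and R :: "('b list \<times> 'b list) set" and \<phi> :: "'b list set \<Rightarrow> 'a"
  assumes fcrs: "finite_complete_rewriting_system G A R \<phi>"
begin

abbreviation irreducible :: "'b list \<Rightarrow> bool" where "irreducible \<equiv> irreducible_word A R"

definition \<mu> :: "'b list \<Rightarrow> 'a" where "\<mu> w = \<phi> (mon_cong A R `` {w})"

lemma finite_A: "finite A" and finite_R: "finite R" and R_lists: "R \<subseteq> lists A \<times> lists A"
  using fcrs by (simp_all add: finite_complete_rewriting_system_def)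

lemma mon_cong_lists: "(u, v) \<in> mon_cong A R \<Longrightarrow> u \<in> lists A \<and> v \<in> lists A"
  by (induction rule: mon_cong.induct) (use R_lists in auto)

lemma equiv_mon_cong: "equiv (lists A) (mon_cong A R)"
proof (rule equivI)
  show "mon_cong A R \<subseteq> lists A \<times> lists A" using mon_cong_lists by auto
  show "refl_on (lists A) (mon_cong A R)" by (rule refl_onI) (rule mon_cong.refl)
  show "sym (mon_cong A R)" by (rule symI) (rule mon_cong.sym)
  show "trans (mon_cong A R)" by (rule transI) (rule mon_cong.trans)
qed

lemma class_carrier: "w \<in> lists A \<Longrightarrow> mon_cong A R `` {w} \<in> carrier (presented_monoid A R)"
  by (simp add: presented_monoid_def quotientI del: in_lists_conv_set)

lemma class_mult:
  assumes "x \<in> lists A" "y \<in> lists A"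
  shows "mon_cong A R `` {x} \<otimes>\<^bsub>presented_monoid A R\<^esub> mon_cong A R `` {y} = mon_cong A R `` {x @ y}"
proof -
  have eq: "mon_cong A R `` {x' @ y'} = mon_cong A R `` {x @ y}"
    if "x' \<in> mon_cong A R `` {x}" "y' \<in> mon_cong A R `` {y}" for x' y'
    using equiv_class_eq[OF equiv_mon_cong mon_cong.append[of x x' A R y y']] that by simp
  have "(\<Union>x'\<in>mon_cong A R `` {x}. \<Union>y'\<in>mon_cong A R `` {y}. mon_cong A R `` {x' @ y'}) =
      (\<Union>x'\<in>mon_cong A R `` {x}. \<Union>y'\<in>mon_cong A R `` {y}. mon_cong A R `` {x @ y})"
    by (intro SUP_cong HOL.refl eq)
  moreover have "x \<in> mon_cong A R `` {x}" "y \<in> mon_cong A R `` {y}"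
    unfolding Image_singleton_iff by (rule mon_cong.refl[OF assms(1)], rule mon_cong.refl[OF assms(2)])
  then have "mon_cong A R `` {x} \<noteq> {}" "mon_cong A R `` {y} \<noteq> {}" by blast+
  ultimately show ?thesis by (simp add: presented_monoid_def)
qed

lemma \<phi>_hom: "\<phi> \<in> hom (presented_monoid A R) G"
  using fcrs by (simp add: finite_complete_rewriting_system_def iso_def)

lemma \<mu>_closed: "w \<in> lists A \<Longrightarrow> \<mu> w \<in> carrier G"
  unfolding \<mu>_def using \<phi>_hom class_carrier by (rule hom_in_carrier)

lemma \<mu>_append: "v \<in> lists A \<Longrightarrow> w \<in> lists A \<Longrightarrow> \<mu> (v @ w) = \<mu> v \<otimes> \<mu> w"
  unfolding \<mu>_def class_mult[symmetric] by (rule hom_mult[OF \<phi>_hom class_carrier class_carrier])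

text \<open>\<open>hom\<close> only provides multiplicativity; \<open>\<mu> []\<close> is
  idempotent, hence the identity of the group.\<close>

lemma \<mu>_Nil: "\<mu> [] = \<one>"
  using \<mu>_append[of "[]" "[]"] \<mu>_closed[of "[]"] by simp

lemma \<mu>_R: "(u, v) \<in> R \<Longrightarrow> \<mu> u = \<mu> v"
  unfolding \<mu>_def
  by (rule arg_cong[where f = \<phi>]) (rule equiv_class_eq[OF equiv_mon_cong mon_cong.base])

lemma rewriting_step_\<mu>:
  assumes "(v, w) \<in> rewriting_step A R"
  shows "v \<in> lists A" "w \<in> lists A" "\<mu> v = \<mu> w"
proof -
  obtain x u u' y where "v = x @ u @ y" "w = x @ u' @ y"
    and l: "x \<in> lists A" "y \<in> lists A" "(u, u') \<in> R"
    using assms unfolding rewriting_step_def by blast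
  moreover have "u \<in> lists A" "u' \<in> lists A" using l(3) R_lists by auto
  ultimately show "v \<in> lists A" "w \<in> lists A" "\<mu> v = \<mu> w"
    using \<mu>_R[OF l(3)] by (simp_all add: \<mu>_append del: in_lists_conv_set)
qed

lemma wf_rewriting: "wf ((rewriting_step A R)\<inverse>)"
  using fcrs by (simp add: finite_complete_rewriting_system_def wf_iff_no_infinite_down_chain)

lemma ex1_irreducible: "g \<in> carrier G \<Longrightarrow> \<exists>!w. irreducible w \<and> \<mu> w = g"
  using fcrs by (simp add: finite_complete_rewriting_system_def \<mu>_def)

definition irr :: "'a \<Rightarrow> 'b list" where "irr g = (THE w. irreducible w \<and> \<mu> w = g)"

lemma irr: "g \<in> carrier G \<Longrightarrow> irreducible (irr g)" "g \<in> carrier G \<Longrightarrow> \<mu> (irr g) = g"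
  using theI'[OF ex1_irreducible] by (simp_all add: irr_def)

lemma irreducible_lists: "irreducible w \<Longrightarrow> w \<in> lists A"
  by (simp add: irreducible_word_def)

lemma irr_\<mu>: "irreducible w \<Longrightarrow> irr (\<mu> w) = w"
  unfolding irr_def
  by (rule the1_equality[OF ex1_irreducible[OF \<mu>_closed[OF irreducible_lists]]]) simp_all

text \<open>Rewriting preserves the element and terminates in an irreducible word, of which each
  element has only one.\<close>

lemma rewrites_to_irr: "w \<in> lists A \<Longrightarrow> (w, irr (\<mu> w)) \<in> (rewriting_step A R)\<^sup>*"
proof (induction w rule: wf_induct_rule[OF wf_rewriting])
  case (1 w)
  show ?case
  proof (cases "irreducible w")
    case True
    then show ?thesis by (simp add: irr_\<mu>)
  next
    case False
    then obtain w' where w': "(w, w') \<in> rewriting_step A R"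
      using 1(2) by (auto simp: irreducible_word_def)
    with 1(1)[of w'] rewriting_step_\<mu>[OF w'] have "(w', irr (\<mu> w)) \<in> (rewriting_step A R)\<^sup>*" by simp
    with w' show ?thesis by (rule converse_rtrancl_into_rtrancl)
  qed
qed

text \<open>A rule with empty left-hand side would apply to every word, contradicting
  termination.\<close>

lemma Nil_notin_R: "([], v) \<notin> R"
proof
  assume v: "([], v) \<in> R"
  then have "v \<in> lists A" using R_lists by auto
  \<comment> \<open>No word could be minimal, so well-founded induction shows that there are no
    words at all.\<close>
  have "w \<notin> lists A" for w
  proof (induction w rule: wf_induct_rule[OF wf_rewriting])
    case (1 w)
    show ?case
    proof
      assume w: "w \<in> lists A"
      then have "([] @ [] @ w, [] @ v @ w) \<in> rewriting_step A R"
        using v unfolding rewriting_step_def by blast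
      then show False using 1[of "v @ w"] w \<open>v \<in> lists A\<close> by simp
    qed
  qed
  from this[of "[]"] show False by simp
qed

lemma irreducible_Nil: "irreducible []"
  using Nil_notin_R by (auto simp: irreducible_word_def rewriting_step_def)

lemma irreducible_letter: "irreducible w \<Longrightarrow> x \<in> set w \<Longrightarrow> irreducible [x]"
  by (rule irreducible_sublist) (auto simp: in_set_conv_decomp sublist_def)

section \<open>Generators of the group and the forbidden factors\<close>

definition p :: "'b \<Rightarrow> 'a" where "p x = \<mu> [x]"

lemma p_closed: "x \<in> A \<Longrightarrow> p x \<in> carrier G"
  by (simp add: p_def \<mu>_closed)

lemma word_val_map_p: "w \<in> lists A \<Longrightarrow> word_val G (map p w) = \<mu> w"
proof (induction w)
  case (Cons x w)
  then show ?case using \<mu>_append[of "[x]" w] by (simp add: p_def)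
qed (simp add: \<mu>_Nil)

lemma irr_p: "irreducible [x] \<Longrightarrow> irr (p x) = [x]"
  by (simp add: p_def irr_\<mu>)

definition B :: "'a set" where "B = (p ` A \<union> m_inv G ` p ` A) - {\<one>}"

text \<open>The irreducible representative of the identity is \<open>[]\<close>, so the irreducible
  word \<open>[x]\<close> represents a nontrivial element.\<close>

lemma p_B: "irreducible [x] \<Longrightarrow> p x \<in> B"
  using irreducible_lists[of "[x]"] irr_p[of x] irr_\<mu>[OF irreducible_Nil] by (auto simp: B_def \<mu>_Nil)

lemma map_p_lists: "irreducible w \<Longrightarrow> map p w \<in> lists B"
  using irreducible_letter p_B by auto

lemma B_carrier: "B \<subseteq> carrier G"
  using p_closed by (auto simp: B_def)

lemma word_val_generate:
  assumes "S \<subseteq> carrier G" "w \<in> lists S" shows "word_val G w \<in> generate G S"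
  using assms(2) by (induction w) (auto intro: generate.one generate.eng generate.incl)

lemma symmetric_generating_set_B: "symmetric_generating_set G B"
proof -
  have "g \<in> generate G B" if "g \<in> carrier G" for g
    using word_val_generate[OF B_carrier map_p_lists[OF irr(1)[OF that]]]
      word_val_map_p[OF irreducible_lists[OF irr(1)[OF that]]] irr(2)[OF that] by simp
  then have "generate G B = carrier G" using generate_incl[OF B_carrier] by auto
  moreover have "inv b \<in> B" if "b \<in> B" for b
    using that p_closed by (auto simp: B_def)
  ultimately show ?thesis
    using B_carrier by (auto simp: symmetric_generating_set_def B_def)
qed

text \<open>Letters of \<open>B\<close> that do not come from an irreducible letter of \<open>A\<close> are rewritten by
  rules of their own.\<close>

definition bad :: "'a \<Rightarrow> bool" where "bad b \<longleftrightarrow> length (irr b) \<noteq> 1"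

text \<open>Left-hand sides with a reducible letter are left out: such a letter occurs in no
  irreducible word. On irreducible letters \<open>p\<close> is injective, with inverse given by
  \<open>irr\<close>, so the remaining left-hand sides are translated faithfully.\<close>

definition forbidden :: "'a list set" where
  "forbidden = map p ` {u \<in> fst ` R. \<forall>x\<in>set u. irreducible [x]} \<union> (\<lambda>b. [b]) ` {b \<in> B. bad b}"

lemma finite_B: "finite B"
  using finite_A by (simp add: B_def)

lemma finite_forbidden: "finite forbidden"
  using finite_R finite_B by (simp add: forbidden_def)

lemma forbidden_lists: "forbidden \<subseteq> lists B"
  using p_B by (auto simp: forbidden_def)

lemma not_badE:
  assumes "b \<in> B" "\<not> bad b" obtains x where "irr b = [x]" "irreducible [x]" "p x = b"
proof -
  have b: "b \<in> carrier G" using assms(1) B_carrier by blast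
  obtain x where x: "irr b = [x]" using assms(2) by (auto simp: bad_def length_Suc_conv)
  then show ?thesis using irr[OF b] by (intro that[of x]) (simp_all add: p_def)
qed

lemma not_bad_p: "irreducible [x] \<Longrightarrow> \<not> bad (p x)"
  by (simp add: bad_def irr_p)

text \<open>Expanding each generator to its irreducible word undoes \<open>p\<close> on irreducible
  letters; the same expansion yields the termination measure.\<close>

lemma concat_irr_p: "\<forall>x\<in>set u. irreducible [x] \<Longrightarrow> concat (map irr (map p u)) = u"
  by (induction u) (auto simp: irr_p)

lemma rewriting_stepI:
  "(u, v) \<in> R \<Longrightarrow> x \<in> lists A \<Longrightarrow> y \<in> lists A \<Longrightarrow> (x @ u @ y, x @ v @ y) \<in> rewriting_step A R"
  unfolding rewriting_step_def by blast

text \<open>A forbidden factor in the image of an irreducible word would be a bad generator, which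
  no irreducible letter represents, or the image of a left-hand side, which makes the word
  reducible. Conversely, an avoiding word has no bad generators, so it can be read as a word of
  irreducible letters; a left-hand side in it would have a forbidden image.\<close>

lemma avoiding_forbidden: "avoiding B forbidden = map p ` Collect irreducible"
proof
  show "map p ` Collect irreducible \<subseteq> avoiding B forbidden"
  proof clarify
    fix w assume w: "irreducible w"
    have "\<not> sublist u (map p w)" if u: "u \<in> forbidden" for u
    proof
      assume "sublist u (map p w)"
      then obtain p1 p2 where "map p w = p1 @ u @ p2" by (auto simp: sublist_def)
      then obtain w1 u' w2 where w': "w = w1 @ u' @ w2" and u': "u = map p u'"
        by (auto simp: map_eq_append_conv append_eq_map_conv)
      have ir: "\<forall>x\<in>set u'. irreducible [x]" using irreducible_letter[OF w] w' by auto
      from u consider u0 v where "u = map p u0" "(u0, v) \<in> R" "\<forall>x\<in>set u0. irreducible [x]"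
        | b where "u = [b]" "bad b"
        by (auto simp: forbidden_def)
      then show False
      proof cases
        case 1
        then have "u' = u0" using concat_irr_p[OF ir] concat_irr_p[of u0] u' by simp
        moreover have "w1 \<in> lists A" "w2 \<in> lists A" using irreducible_lists[OF w] w' by auto
        ultimately have "(w, w1 @ v @ w2) \<in> rewriting_step A R"
          using rewriting_stepI[OF 1(2), of w1 w2] w' by (simp del: in_lists_conv_set)
        then show False using w by (auto simp: irreducible_word_def)
      next
        case 2
        then show False using u' ir not_bad_p by auto
      qed
    qed
    then show "map p w \<in> avoiding B forbidden" using map_p_lists[OF w] by (simp add: avoiding_def)
  qed
  show "avoiding B forbidden \<subseteq> map p ` Collect irreducible"
  proof
    fix w assume w: "w \<in> avoiding B forbidden"
    then have wB: "w \<in> lists B" and av: "\<And>u. u \<in> forbidden \<Longrightarrow> \<not> sublist u w"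
      by (auto simp: avoiding_def)
    have good: "\<not> bad b" if "b \<in> set w" for b
    proof
      assume "bad b"
      then have "[b] \<in> forbidden" using that wB by (auto simp: forbidden_def)
      moreover have "sublist [b] w" using that by (auto simp: in_set_conv_decomp sublist_def)
      ultimately show False using av by blast
    qed
    \<comment> \<open>For a generator \<open>b\<close> that is not bad, \<open>irr b\<close> has a
      single letter, which \<open>hd\<close> extracts.\<close>
    define w' where "w' = map (\<lambda>b. hd (irr b)) w"
    have letters: "irreducible [hd (irr b)] \<and> p (hd (irr b)) = b" if "b \<in> set w" for b
      using not_badE[OF _ good[OF that]] wB that by (metis in_listsD list.sel(1))
    then have w'w: "map p w' = w" by (auto simp: w'_def intro: map_idI)
    have ir: "\<forall>x\<in>set w'. irreducible [x]" using letters by (auto simp: w'_def)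
    have "irreducible w'"
    proof -
      have "x \<in> A" if "x \<in> set w'" for x
        using irreducible_lists[of "[x]"] ir that by simp
      then have "w' \<in> lists A" by blast
      moreover have False if st: "(w', v') \<in> rewriting_step A R" for v'
      proof -
        obtain x u v z where 1: "w' = x @ u @ z" "(u, v) \<in> R"
          using st unfolding rewriting_step_def by blast
        have "u \<in> fst ` R" using 1(2) by (rule image_eqI[rotated]) simp
        then have "map p u \<in> forbidden" using ir 1(1) by (simp add: forbidden_def)
        moreover have "sublist (map p u) w" using 1 w'w by (auto simp: sublist_def)
        ultimately show False using av by blast
      qed
      ultimately show ?thesis by (auto simp: irreducible_word_def)
    qed
    then show "w \<in> map p ` Collect irreducible" using w'w by blast
  qed
qed

lemma normal_forms_B: "normal_forms G B (map p ` Collect irreducible)"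
  unfolding normal_forms_def
proof (intro conjI ballI)
  show "map p ` Collect irreducible \<subseteq> lists B" using map_p_lists by blast
  fix g assume g: "g \<in> carrier G"
  show "\<exists>!w. w \<in> map p ` Collect irreducible \<and> word_val G w = g"
  proof (rule ex1I[of _ "map p (irr g)"])
    show "map p (irr g) \<in> map p ` Collect irreducible \<and> word_val G (map p (irr g)) = g"
      using irr[OF g] by (simp add: word_val_map_p irreducible_lists del: in_lists_conv_set)
    fix w assume "w \<in> map p ` Collect irreducible \<and> word_val G w = g"
    then obtain v where "irreducible v" "w = map p v" "\<mu> v = g"
      using word_val_map_p irreducible_lists by auto
    then show "w = map p (irr g)" using irr_\<mu> by auto
  qed
qed

lemma nf_eq: "g \<in> carrier G \<Longrightarrow> nf G (map p ` Collect irreducible) g = map p (irr g)"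
proof -
  assume g: "g \<in> carrier G"
  have "\<exists>!w. w \<in> map p ` Collect irreducible \<and> word_val G w = g"
    using normal_forms_B g by (simp add: normal_forms_def)
  moreover have "map p (irr g) \<in> map p ` Collect irreducible \<and> word_val G (map p (irr g)) = g"
    using irr[OF g] by (simp add: word_val_map_p irreducible_lists del: in_lists_conv_set)
  ultimately show ?thesis unfolding nf_def by (rule the1_equality)
qed

text \<open>Expand every generator \<open>b\<close> to the word \<open>irr b\<close> over
  \<open>A\<close>. Replacing the image of a left-hand side rewrites the expansion at least once;
  replacing a bad generator keeps the expansion but lowers the number of bad generators, as normal
  forms contain none. A lexicographic measure combines the two.\<close>

lemma wf_forbidden:
  "wf {(x @ nf G (map p ` Collect irreducible) (word_val G u) @ z, x @ u @ z) | x u z.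
     x \<in> lists B \<and> z \<in> lists B \<and> u \<in> forbidden}" (is "wf ?r")
proof (rule wf_subset)
  let ?h = "\<lambda>w. concat (map irr w)"
  let ?s = "inv_image (((rewriting_step A R)\<inverse>)\<^sup>+ <*lex*> less_than)
    (\<lambda>w. (?h w, length (filter bad w)))"
  show "wf ?s"
    by (intro wf_inv_image wf_lex_prod wf_trancl wf_rewriting wf_less_than)
  show "?r \<subseteq> ?s"
  proof
    fix e assume "e \<in> ?r"
    then obtain x u z where x: "x \<in> lists B" and z: "z \<in> lists B" and u: "u \<in> forbidden"
      and e: "e = (x @ nf G (map p ` Collect irreducible) (word_val G u) @ z, x @ u @ z)" by blast
    have h: "?h w \<in> lists A" if "w \<in> lists B" for w
      using that
    proof (induction w)
      case (Cons b w)
      then have "b \<in> carrier G" using B_carrier by auto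
      then have "irr b \<in> lists A" by (intro irreducible_lists irr)
      then show ?case using Cons by simp
    qed simp
    have uB: "u \<in> lists B" using u forbidden_lists by blast
    then have val: "word_val G u \<in> carrier G"
      using word_val_closed subsetD[OF lists_mono[OF B_carrier]] by simp
    have ir: "\<forall>x\<in>set (irr (word_val G u)). irreducible [x]"
      using irreducible_letter[OF irr(1)[OF val]] by simp
    let ?n = "map p (irr (word_val G u))"
    have hn: "?h ?n = irr (word_val G u)" by (rule concat_irr_p[OF ir])
    have "(x @ ?n @ z, x @ u @ z) \<in> ?s"
    proof -
      from u consider u0 v where "u = map p u0" "(u0, v) \<in> R" "\<forall>x\<in>set u0. irreducible [x]"
        | b where "u = [b]" "bad b" "b \<in> B"
        by (auto simp: forbidden_def)
      then show ?thesis
      proof cases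
        case 1
        have u0: "u0 \<in> lists A" using 1(2) R_lists by auto
        have hu: "?h u = u0" unfolding 1(1) by (rule concat_irr_p[OF 1(3)])
        \<comment> \<open>A left-hand side is reducible, hence different from its irreducible form,
          so at least one rewriting step is made.\<close>
        have "(u0, v) \<in> rewriting_step A R" using rewriting_stepI[OF 1(2), of "[]" "[]"] by simp
        then have "\<not> irreducible u0" by (auto simp: irreducible_word_def)
        moreover have "(u0, irr (word_val G u)) \<in> (rewriting_step A R)\<^sup>*"
          using rewrites_to_irr[OF u0] word_val_map_p[OF u0] 1(1) by simp
        ultimately have "(u0, irr (word_val G u)) \<in> (rewriting_step A R)\<^sup>+"
          using irr(1)[OF val] by (metis rtranclD)
        from rewriting_steps_context[OF this h[OF x] h[OF z]]
        have "(?h (x @ u @ z), ?h (x @ ?n @ z)) \<in> (rewriting_step A R)\<^sup>+"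
          unfolding map_append concat_append hu hn .
        then show ?thesis by (simp add: trancl_converse)
      next
        case 2
        have "word_val G u = b" using 2 B_carrier by auto
        then have "?h (x @ u @ z) = ?h (x @ ?n @ z)" using hn 2(1) by simp
        moreover have "filter bad ?n = []" using ir not_bad_p by (auto simp: filter_empty_conv)
        then have "length (filter bad (x @ ?n @ z)) < length (filter bad (x @ u @ z))"
          using 2 by simp
        ultimately show ?thesis by simp
      qed
    qed
    then show "e \<in> ?s" unfolding e nf_eq[OF val] .
  qed
qed

lemma regularly_stackable: "regularly_stackable G"
proof -
  obtain L where L: "set L = forbidden" using finite_list[OF finite_forbidden] by blast
  interpret avoiding_normal_forms G B L
    by unfold_locales
      (use finite_B symmetric_generating_set_B forbidden_lists normal_forms_B wf_forbidden
        in \<open>simp_all add: L avoiding_forbidden\<close>)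
  show ?thesis by (rule regularly_stackable)
qed

end

theorem theorem5p1:
  fixes G :: "('a, 'm) monoid_scheme"
    and A :: "'b set"
    and R :: "('b list \<times> 'b list) set"
    and \<phi> :: "'b list set \<Rightarrow> 'a"
  assumes "group G"
    and "finite_complete_rewriting_system G A R \<phi>"
  shows "regularly_stackable G"
proof -
  interpret complete_rewriting G A R \<phi>
    using assms by (simp add: complete_rewriting_def complete_rewriting_axioms_def)
  show ?thesis by (rule regularly_stackable)
qed

end
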